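(* For each $n\geq 1$ and $k\geq 0$, the number of $2$-pop-stack-sortable elements of $B_n$ with $2k$ or $2k+1$ descending runs is equal to the number of $2$-pop-stack-sortable permutations in $S_{n+1}$ with exactly $k+1$ descending runs. In particular, \[\sum_{n\geq 1}\left|\mathrm{Pop}_{B_n}^{-2}(e)\right|z^n=\sum_{n\geq 1}\left|\mathrm{Pop}_{S_{n+1}}^{-2}(e)\right|z^n=\frac{2z(1+z+z^2)}{1-2z-z^2-2z^3}.\]
   Context: $S_m$ is the symmetric group on $[m]$, a Coxeter group with simple generators $s_i=(i\ i+1)$, $i\in[m-1]$. For a Coxeter system $(W,S)$ with length $\ell$, right weak order $x\leq_R y$ iff $\ell(x^{-1}y)=\ell(y)-\ell(x)$ (a complete meet-semilattice with meet $\bigwedge_R$), and right descent set $D_R(w)=\{s\in S:\ell(ws)<\ell(w)\}$, define $\mathrm{Pop}_W(w)=\bigwedge_R(\{ws:s\in D_R(w)\}\cup\{w\})$; $w$ is $t$-pop-stack-sortable if $\mathrm{Pop}_W^t(w)=e$. (On $S_m$, $\mathrm{Pop}$ reverses each descending run of the one-line notation.) The hyperoctahedral group $B_n$ is the subgroup of $S_{2n}$ of permutations $w$ with $w_0ww_0=w$, where $w_0=(2n)(2n-1)\cdots 1$; it is a Coxeter group with simple generators $s_is_{2n-i}$ ($i\in[n-1]$) and $s_n$. A descending run of a permutation (for elements of $B_n$, of its one-line notation as a permutation of $[2n]$) is a maximal consecutive decreasing subsequence of its one-line notation. *)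

theory Defs
  imports
    "HOL-Algebra.Sym_Groups"
    "HOL-Algebra.Lattice"
    "HOL-Computational_Algebra.Formal_Power_Series"
begin

text \<open>
  The notions of this block make sense for any group \<open>W\<close> with a generating set \<open>S\<close>. They are
  used for the Coxeter systems of the symmetric and the hyperoctahedral groups.
\<close>

text \<open>
  The word length of \<open>w\<close> with respect to \<open>S\<close>. It is unspecified when \<open>S\<close> does not generate \<open>w\<close>.
\<close>

definition coxeter_length :: "('a, 'b) monoid_scheme \<Rightarrow> 'a set \<Rightarrow> 'a \<Rightarrow> nat" where
  "coxeter_length W S w =
     (LEAST l. \<exists>ss. set ss \<subseteq> S \<and> length ss = l \<and> foldr (\<lambda>x y. x \<otimes>\<^bsub>W\<^esub> y) ss \<one>\<^bsub>W\<^esub> = w)"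

text \<open>The lengths are subtracted as integers, since subtraction of naturals truncates.\<close>

definition right_weak_order :: "('a, 'b) monoid_scheme \<Rightarrow> 'a set \<Rightarrow> 'a gorder" where
  "right_weak_order W S =
     \<lparr> carrier = carrier W, eq = (=),
       le = (\<lambda>x y. int (coxeter_length W S (inv\<^bsub>W\<^esub> x \<otimes>\<^bsub>W\<^esub> y)) =
                   int (coxeter_length W S y) - int (coxeter_length W S x)) \<rparr>"

definition right_descents :: "('a, 'b) monoid_scheme \<Rightarrow> 'a set \<Rightarrow> 'a \<Rightarrow> 'a set" where
  "right_descents W S w = {s \<in> S. coxeter_length W S (w \<otimes>\<^bsub>W\<^esub> s) < coxeter_length W S w}"

definition pop :: "('a, 'b) monoid_scheme \<Rightarrow> 'a set \<Rightarrow> 'a \<Rightarrow> 'a" where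
  "pop W S w =
     \<Sqinter>\<^bsub>right_weak_order W S\<^esub> ({w \<otimes>\<^bsub>W\<^esub> s | s. s \<in> right_descents W S w} \<union> {w})"

definition pop_stack_sortable :: "nat \<Rightarrow> ('a, 'b) monoid_scheme \<Rightarrow> 'a set \<Rightarrow> 'a set" where
  "pop_stack_sortable t W S = {w \<in> carrier W. (pop W S ^^ t) w = \<one>\<^bsub>W\<^esub>}"

text \<open>
  The product of \<^const>\<open>sym_group\<close> is \<^term>\<open>(\<circ>)\<close>, so multiplying \<open>w\<close> by \<open>adj i\<close> on the right
  exchanges the entries in positions \<open>i\<close> and \<open>i + 1\<close> of the one-line notation \<open>w 1, \<dots>, w m\<close>.
\<close>

definition adj :: "nat \<Rightarrow> nat \<Rightarrow> nat" where
  "adj i = Transposition.transpose i (i + 1)"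

definition sym_gens :: "nat \<Rightarrow> (nat \<Rightarrow> nat) set" where
  "sym_gens m = {adj i | i. i \<in> {1..m - 1}}"

text \<open>
  The permutation \<open>m (m - 1) \<dots> 1\<close>, extended by the identity outside \<open>{1..m}\<close>, as \<open>permutes\<close>
  requires.
\<close>

definition rev_perm :: "nat \<Rightarrow> nat \<Rightarrow> nat" where
  "rev_perm m = (\<lambda>i. if i \<in> {1..m} then m + 1 - i else i)"

definition hyperoctahedral_group :: "nat \<Rightarrow> (nat \<Rightarrow> nat) monoid" where
  "hyperoctahedral_group n =
     sym_group (2 * n)
       \<lparr> carrier := {w \<in> carrier (sym_group (2 * n)).
                       rev_perm (2 * n) \<circ> w \<circ> rev_perm (2 * n) = w} \<rparr>"

definition hyperoctahedral_gens :: "nat \<Rightarrow> (nat \<Rightarrow> nat) set" where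
  "hyperoctahedral_gens n = {adj i \<circ> adj (2 * n - i) | i. i \<in> {1..n - 1}} \<union> {adj n}"

text \<open>
  A consecutive subsequence of the one-line notation \<open>w 1, \<dots>, w m\<close> is represented by the
  nonempty interval of its positions.
\<close>

definition decreasing_block :: "nat \<Rightarrow> (nat \<Rightarrow> nat) \<Rightarrow> nat set \<Rightarrow> bool" where
  "decreasing_block m w A \<longleftrightarrow>
     (\<exists>a b. 1 \<le> a \<and> a \<le> b \<and> b \<le> m \<and> A = {a..b}) \<and> strict_antimono_on A w"

definition descending_runs :: "nat \<Rightarrow> (nat \<Rightarrow> nat) \<Rightarrow> nat set set" where
  "descending_runs m w =
     {A. decreasing_block m w A \<and> (\<forall>B. decreasing_block m w B \<and> A \<subseteq> B \<longrightarrow> B = A)}"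

abbreviation pop_sortable_S :: "nat \<Rightarrow> nat \<Rightarrow> (nat \<Rightarrow> nat) set" where
  "pop_sortable_S t m \<equiv> pop_stack_sortable t (sym_group m) (sym_gens m)"

abbreviation pop_sortable_B :: "nat \<Rightarrow> nat \<Rightarrow> (nat \<Rightarrow> nat) set" where
  "pop_sortable_B t n \<equiv>
     pop_stack_sortable t (hyperoctahedral_group n) (hyperoctahedral_gens n)"

end

theory Submission
  imports Defs
begin

text \<open>
  In both types the weak order is containment of inversion sets, so \<open>Pop\<close> reverses every descending
  run: \<open>Pop w = w \<circ> \<rho>\<^sub>C\<close>, where \<open>C\<close> is the set of ascents of \<open>w\<close> and \<open>\<rho>\<^sub>C\<close> is the involution reversing
  each block cut out by \<open>C\<close>. If \<open>E\<close> is the set of ascents of \<open>Pop w\<close>, then \<open>Pop (Pop w) = e\<close> says that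
  \<open>w = \<rho>\<^sub>E \<circ> \<rho>\<^sub>C\<close>. A pair \<open>(C, E)\<close> arises from \<open>S\<^sub>m\<close> iff \<open>C \<union> E = {1..m - 1}\<close> and every \<open>q \<in> C - E\<close> has a
  neighbour \<open>q \<plusminus> 1\<close> in \<open>{1..m - 1} - C\<close>; it arises from \<open>B\<^sub>n\<close> iff moreover \<open>m = 2 n\<close> and both sets are
  symmetric about \<open>n\<close>. Restricting symmetric pairs to \<open>{1..n}\<close> gives exactly the pairs of \<open>S\<^sub>n\<^sub>+\<^sub>1\<close>, and the
  number of runs of \<open>w\<close> is \<open>card C + 1\<close>. Deleting \<open>n\<close> from a pair leads to the linear recurrence behind
  the generating function.
\<close>

section \<open>Reversing the blocks of an interval\<close>

text \<open>\<open>pop\<close> is defined through word lengths and a meet, so lengths must be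
  computed. In type B the number of inversions is not the length: \<open>adj n\<close> creates one
  inversion, every other generator two. Giving pairs of opposite values double weight evens this
  out, and one argument then serves both types. The meet is found by exhibiting a greatest lower
  bound. The conditions on \<open>(C, E)\<close> come from looking at gaps. Reversing a run turns
  its inner descents into ascents, so a gap outside \<open>C\<close> lies in \<open>E\<close>. At
  \<open>q \<in> C\<close>, \<open>Pop w\<close> compares the first entry of the run ending at
  \<open>q\<close> with the last entry of the run starting at \<open>q + 1\<close>. If both runs are
  singletons, these entries are \<open>w q < w (q + 1)\<close> and \<open>q\<close> stays an ascent;
  so \<open>q \<notin> E\<close> forces a longer run beside \<open>q\<close>, that is, an uncut
  neighbour. Conversely, either \<open>q\<close> or that neighbour is a cut of \<open>E\<close>
  separating the outer ends of the two runs, and such a cut makes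
  \<open>\<rho>\<^sub>E \<circ> \<rho>\<^sub>C\<close> increase at \<open>q\<close>.\<close>

text \<open>
  A set \<open>C \<subseteq> {1..<m}\<close> of cuts divides \<open>{1..m}\<close> into blocks: \<open>c \<in> C\<close> separates \<open>c\<close> from \<open>c + 1\<close>.
\<close>

definition block_start :: "nat set \<Rightarrow> nat \<Rightarrow> nat" where
  "block_start C i = Suc (Max (insert 0 (C \<inter> {..<i})))"

text \<open>A cut is the last position of its block, hence \<open>{i..}\<close> here against
  \<open>{..<i}\<close> in \<open>block_start\<close>. The inserted \<open>m\<close> and
  \<open>0\<close> are the outer boundaries.\<close>

definition block_end :: "nat \<Rightarrow> nat set \<Rightarrow> nat \<Rightarrow> nat" where
  "block_end m C i = Min (insert m (C \<inter> {i..}))"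

definition block_rev :: "nat \<Rightarrow> nat set \<Rightarrow> nat \<Rightarrow> nat" where
  "block_rev m C i = (if i \<in> {1..m} then block_start C i + block_end m C i - i else i)"

lemma block_start_le: "1 \<le> i \<Longrightarrow> block_start C i \<le> i"
  by (auto simp: block_start_def Suc_le_eq)

lemma block_start_pos: "1 \<le> block_start C i"
  by (simp add: block_start_def)

lemma block_start_cut: "block_start C i = 1 \<or> block_start C i - 1 \<in> C"
proof -
  have "Max (insert 0 (C \<inter> {..<i})) \<in> insert 0 (C \<inter> {..<i})"
    by (rule Max_in) auto
  then show ?thesis by (auto simp: block_start_def)
qed

lemma less_block_start: "c \<in> C \<Longrightarrow> c < i \<Longrightarrow> c < block_start C i"
  by (simp add: block_start_def less_Suc_eq_le)

context
  fixes m :: nat and C :: "nat set"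
  assumes C: "C \<subseteq> {1..<m}"
begin

lemma finite_cuts: "finite C"
  using C finite_subset by blast

lemma block_end_ge: "i \<le> m \<Longrightarrow> i \<le> block_end m C i"
  using finite_cuts by (auto simp: block_end_def)

lemma block_end_le: "block_end m C i \<le> m"
  using finite_cuts by (auto simp: block_end_def)

lemma block_end_cut: "block_end m C i = m \<or> block_end m C i \<in> C"
proof -
  have "Min (insert m (C \<inter> {i..})) \<in> insert m (C \<inter> {i..})"
    by (rule Min_in) (auto simp: finite_cuts)
  then show ?thesis by (auto simp: block_end_def)
qed

lemma block_end_le_cut: "c \<in> C \<Longrightarrow> i \<le> c \<Longrightarrow> block_end m C i \<le> c"
  using finite_cuts by (simp add: block_end_def)

lemma no_cut_in_block: "1 \<le> i \<Longrightarrow> block_start C i \<le> c \<Longrightarrow> c < block_end m C i \<Longrightarrow> c \<notin> C"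
  using block_end_le_cut[of c i] less_block_start[of c C i] by linarith

text \<open>The means of recognising blocks that are given by their boundaries, such as mirror
  images of blocks and runs of a permutation.\<close>

lemma block_unique:
  assumes "1 \<le> a" "a \<le> i" "i \<le> b" "b \<le> m" and "\<And>c. a \<le> c \<Longrightarrow> c < b \<Longrightarrow> c \<notin> C"
    and "a = 1 \<or> a - 1 \<in> C" and "b = m \<or> b \<in> C"
  shows "block_start C i = a" "block_end m C i = b"
proof -
  have "i \<le> m" "1 \<le> i" using assms by auto
  show "block_start C i = a"
  proof (rule antisym)
    show "block_start C i \<le> a"
    proof (rule ccontr)
      assume *: "\<not> block_start C i \<le> a"
      then have "block_start C i - 1 \<in> C"
        using block_start_cut[of C i] assms(1) by auto
      moreover have "a \<le> block_start C i - 1" "block_start C i - 1 < b"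
        using * block_start_le[of i C] \<open>1 \<le> i\<close> assms by auto
      ultimately show False using assms(5) by blast
    qed
    show "a \<le> block_start C i"
      using assms(6)
    proof
      assume "a - 1 \<in> C"
      moreover have "a - 1 < i" using assms(1,2) by simp
      ultimately show ?thesis using less_block_start[of "a - 1" C i] by linarith
    qed (use block_start_pos in simp)
  qed
  show "block_end m C i = b"
  proof (rule antisym)
    show "block_end m C i \<le> b"
      using assms(7) block_end_le_cut[OF _ assms(3)] block_end_le[of i] by (elim disjE) simp_all
    show "b \<le> block_end m C i"
    proof (rule ccontr)
      assume *: "\<not> b \<le> block_end m C i"
      then have "block_end m C i \<in> C"
        using block_end_cut[of i] assms(4) by linarith
      moreover have "a \<le> block_end m C i"
        using block_end_ge[OF \<open>i \<le> m\<close>] assms by linarith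
      ultimately show False using assms(5)[of "block_end m C i"] * by simp
    qed
  qed
qed

lemma block_same:
  assumes "i \<in> {1..m}" "j \<in> {block_start C i..block_end m C i}"
  shows "block_start C j = block_start C i" "block_end m C j = block_end m C i"
proof -
  have *: "1 \<le> block_start C i" "block_start C i \<le> j" "j \<le> block_end m C i" "block_end m C i \<le> m"
    "\<And>c. block_start C i \<le> c \<Longrightarrow> c < block_end m C i \<Longrightarrow> c \<notin> C"
    using assms no_cut_in_block[of i] block_start_pos[of C i] block_end_le by auto
  show "block_start C j = block_start C i" "block_end m C j = block_end m C i"
    using block_unique[OF * block_start_cut block_end_cut] by blast+
qed

lemma block_rev_in_block:
  assumes "i \<in> {1..m}"
  shows "block_rev m C i \<in> {block_start C i..block_end m C i}"
  using assms block_start_le[of i C] block_end_ge[of i] by (auto simp: block_rev_def)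

lemma block_rev_in: "i \<in> {1..m} \<Longrightarrow> block_rev m C i \<in> {1..m}"
  using block_rev_in_block[of i] block_start_pos[of C i] block_end_le[of i]
  unfolding atLeastAtMost_iff by linarith

lemma block_rev_block_rev [simp]: "block_rev m C (block_rev m C i) = i"
proof (cases "i \<in> {1..m}")
  case True
  show ?thesis
    using block_same[OF True block_rev_in_block[OF True]] block_rev_in[OF True] True
      block_start_le[of i C] block_end_ge[of i]
    by (simp add: block_rev_def)
qed (auto simp: block_rev_def)

lemma block_rev_comp_block_rev [simp]: "block_rev m C \<circ> block_rev m C = id"
  by (simp add: fun_eq_iff)

lemma block_rev_permutes: "block_rev m C permutes {1..m}"
proof (rule bij_imp_permutes)
  show "bij_betw (block_rev m C) {1..m} {1..m}"
    by (rule bij_betwI[where g = "block_rev m C"]) (use block_rev_in in auto)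
qed (unfold block_rev_def, rule if_not_P)

text \<open>No position crosses a cut. Together with \<open>cut_less_block_rev\<close>, a single cut
  between two positions guarantees that the reversal keeps their order.\<close>

lemma block_rev_le_cut: "c \<in> C \<Longrightarrow> i \<le> c \<Longrightarrow> block_rev m C i \<le> c"
  using block_end_le_cut[of c i] block_rev_in_block[of i] C
  by (cases "i \<in> {1..m}") (auto simp: block_rev_def)

lemma cut_less_block_rev: "c \<in> C \<Longrightarrow> c < i \<Longrightarrow> c < block_rev m C i"
  using less_block_start[of c C i] block_rev_in_block[of i]
  by (cases "i \<in> {1..m}") (auto simp: block_rev_def)

lemma block_Suc:
  assumes "i \<in> {1..<m}" "i \<notin> C"
  shows "block_start C (Suc i) = block_start C i" "block_end m C (Suc i) = block_end m C i"
proof -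
  have "i < block_end m C i"
    using block_end_ge[of i] block_end_cut[of i] assms by (cases "block_end m C i = i") auto
  then have "Suc i \<in> {block_start C i..block_end m C i}"
    using assms block_start_le[of i C] by auto
  then show "block_start C (Suc i) = block_start C i" "block_end m C (Suc i) = block_end m C i"
    using block_same[of i "Suc i"] assms by auto
qed

text \<open>The reversal permutes uncut gaps and exchanges their two sides. Claims about adjacent
  positions in a block are carried through a composition with \<open>block_rev\<close> in this
  way.\<close>

lemma block_rev_Suc:
  assumes "i \<in> {1..<m}" "i \<notin> C"
  shows "block_rev m C i = Suc (block_rev m C (Suc i))"
    "block_rev m C (Suc i) \<in> {1..<m} - C"
proof -
  have i: "i \<in> {1..m}" "Suc i \<in> {1..m}" using assms by auto
  note * = block_Suc[OF assms] block_start_le[of i C] block_end_ge[of "Suc i"] block_end_le[of i]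
    block_start_pos[of C i]
  show 1: "block_rev m C i = Suc (block_rev m C (Suc i))"
    using i * by (auto simp: block_rev_def)
  have "block_rev m C (Suc i) < block_end m C i" "block_start C i \<le> block_rev m C (Suc i)"
    using block_rev_in_block[of i] block_rev_in_block[of "Suc i"] i * 1 by auto
  then show "block_rev m C (Suc i) \<in> {1..<m} - C"
    using no_cut_in_block[of i] i * by auto
qed

lemma block_cut:
  assumes "i \<in> C"
  shows "block_end m C i = i" "block_start C (Suc i) = Suc i"
  using block_end_le_cut[OF assms order_refl] block_end_ge[of i] less_block_start[OF assms, of "Suc i"]
    block_start_le[of "Suc i" C] assms C by auto

text \<open>At a cut two blocks meet, the left one ending in \<open>i\<close> and the right one
  starting in \<open>Suc i\<close>. The reversal sends these two positions to the outer ends of the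
  two blocks.\<close>

lemma block_rev_cut:
  assumes "i \<in> C"
  shows "block_rev m C i = block_start C i" "block_rev m C (Suc i) = block_end m C (Suc i)"
  using block_cut[OF assms] assms C by (auto simp: block_rev_def)

lemma not_same_block_cut:
  assumes "p < q" "q \<le> m" "block_end m C p < q"
  obtains c where "c \<in> C" "p \<le> c" "c < q"
  using that[of "block_end m C p"] block_end_ge[of p] block_end_cut[of p] assms by linarith

end

section \<open>Inversions and the word length\<close>

text \<open>
  Inversions are recorded as pairs of values, not of positions. Then right multiplication by a
  generator changes the set of inversions of \<open>w\<close> by very few elements, and left multiplication acts
  on the pairs on which two permutations disagree.
\<close>

definition disagree :: "nat \<Rightarrow> (nat \<Rightarrow> nat) \<Rightarrow> (nat \<Rightarrow> nat) \<Rightarrow> (nat \<times> nat) set" where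
  "disagree m x y = {(a, b). a \<in> {1..m} \<and> b \<in> {1..m} \<and> inv' x a < inv' x b \<and> inv' y b < inv' y a}"

abbreviation inversions :: "nat \<Rightarrow> (nat \<Rightarrow> nat) \<Rightarrow> (nat \<times> nat) set" where
  "inversions m \<equiv> disagree m id"

definition ascents :: "nat \<Rightarrow> (nat \<Rightarrow> nat) \<Rightarrow> nat set" where
  "ascents m w = {i \<in> {1..<m}. w i < w (Suc i)}"

lemma ascents_subset: "ascents m w \<subseteq> {1..<m}"
  by (auto simp: ascents_def)

lemma finite_disagree: "finite (disagree m x y)"
  by (rule finite_subset[of _ "{1..m} \<times> {1..m}"]) (auto simp: disagree_def)

lemma disagree_same [simp]: "disagree m x x = {}"
  by (auto simp: disagree_def)

lemma inversions_iff:
  "(a, b) \<in> inversions m w \<longleftrightarrow> a \<in> {1..m} \<and> b \<in> {1..m} \<and> a < b \<and> inv' w b < inv' w a"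
  by (auto simp: disagree_def)

lemma disagree_triangle:
  assumes "y permutes {1..m}"
  shows "disagree m x z \<subseteq> disagree m x y \<union> disagree m y z"
proof (rule subrelI)
  fix a b assume "(a, b) \<in> disagree m x z"
  moreover from this have "a \<noteq> b" by (auto simp: disagree_def)
  then have "inv' y a \<noteq> inv' y b"
    using assms by (metis permutes_inverses(1))
  ultimately show "(a, b) \<in> disagree m x y \<union> disagree m y z"
    by (auto simp: disagree_def)
qed

text \<open>A disagreement \<open>(a, b)\<close> with \<open>a < b\<close> is inverted by
  \<open>y\<close> only; one with \<open>a > b\<close> is the reverse of a pair inverted by
  \<open>x\<close> only, whence the converse.\<close>

lemma disagree_eq_inversions:
  assumes "x permutes {1..m}" "y permutes {1..m}"
  shows "disagree m x y = (inversions m y - inversions m x) \<union> (inversions m x - inversions m y)\<inverse>"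
proof -
  have ne: "inv' y a \<noteq> inv' y b" "inv' x a \<noteq> inv' x b" if "a \<noteq> b" for a b
    using assms that by (metis permutes_inverses(1))+
  have "(a, b) \<in> disagree m x y \<longleftrightarrow>
      (a, b) \<in> (inversions m y - inversions m x) \<union> (inversions m x - inversions m y)\<inverse>" for a b
    by (cases a b rule: linorder_cases)
      (use ne[of a b] in \<open>auto simp: inversions_iff disagree_def[of m x y]\<close>)
  then show ?thesis by auto
qed

text \<open>Left multiplication only renames values: \<open>g a\<close> stands in
  \<open>g \<circ> x\<close> where \<open>a\<close> stands in \<open>x\<close>.\<close>

lemma disagree_left_mult:
  assumes "g permutes {1..m}" "x permutes {1..m}" "y permutes {1..m}"
  shows "disagree m (g \<circ> x) (g \<circ> y) = map_prod g g ` disagree m x y" (is "?L = ?R")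
proof -
  have inv: "inv' (g \<circ> x) = inv' x \<circ> inv' g" "inv' (g \<circ> y) = inv' y \<circ> inv' g"
    using assms permutes_bij o_inv_distrib by metis+
  have g: "g a \<in> {1..m} \<longleftrightarrow> a \<in> {1..m}" "inv' g (g a) = a" for a
    using permutes_in_image[OF assms(1)] permutes_inverses[OF assms(1)] by auto
  show ?thesis
  proof (intro equalityI subsetI)
    fix z assume z: "z \<in> ?L"
    obtain a b where ab: "z = (g a, g b)"
      by (metis permutes_inverses(1)[OF assms(1)] surj_pair)
    have "(a, b) \<in> disagree m x y"
      using z g unfolding ab disagree_def inv by auto
    then show "z \<in> ?R" using ab by auto
  next
    fix z assume "z \<in> ?R"
    then show "z \<in> ?L" using g unfolding disagree_def inv by auto
  qed
qed

lemma no_descents_imp_id: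
  assumes w: "w permutes {1..m}" and "\<And>i. i \<in> {1..<m} \<Longrightarrow> w i < w (Suc i)"
  shows "w = id"
proof (rule permutes_natset_ge[OF w], intro ballI)
  fix i assume "i \<in> {1..m}"
  then have "1 \<le> i" "i \<le> m" by auto
  then show "i \<le> w i"
  proof (induction i rule: nat_induct_at_least)
    case base
    then show ?case using permutes_in_image[OF w, of 1] by simp
  next
    case (Suc i)
    then have "i \<le> w i" "w i < w (Suc i)" using assms(2)[of i] by simp_all
    then show ?case by linarith
  qed
qed

lemma adj_apply: "adj i k = (if k = i then Suc i else if k = Suc i then i else k)"
  by (simp add: adj_def Transposition.transpose_def)

lemma adj_permutes: "i \<in> {1..<m} \<Longrightarrow> adj i permutes {1..m}"
  by (auto simp: adj_def intro: permutes_swap_id)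

lemma adj_comp_adj [simp]: "adj i \<circ> adj i = id"
  by (auto simp: fun_eq_iff adj_apply)

lemma inversions_comp_adj:
  assumes w: "w permutes {1..m}" and i: "i \<in> {1..<m}" and desc: "w (Suc i) < w i"
  shows "inversions m (w \<circ> adj i) = inversions m w - {(w (Suc i), w i)}"
proof -
  have "inv' (adj i) = adj i"
    by (rule inv_unique_comp) auto
  then have inv: "inv' (w \<circ> adj i) = adj i \<circ> inv' w"
    using permutes_bij[OF w] permutes_bij[OF adj_permutes[OF i]] o_inv_distrib by metis
  have order: "adj i p < adj i q \<longleftrightarrow> (p < q \<and> \<not> (p = i \<and> q = Suc i)) \<or> (p = Suc i \<and> q = i)" for p q
    by (auto simp: adj_apply)
  have "(a, b) \<in> inversions m (w \<circ> adj i) \<longleftrightarrow> (a, b) \<in> inversions m w - {(w (Suc i), w i)}" for a b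
  proof -
    define p q where "p = inv' w a" and "q = inv' w b"
    have "a = w p" "b = w q" and pq: "p = k \<longleftrightarrow> a = w k" "q = k \<longleftrightarrow> b = w k" for k
      unfolding p_def q_def using permutes_inverses[OF w] by metis+
    moreover have "a < b \<Longrightarrow> \<not> (q = Suc i \<and> p = i)"
      using desc pq by auto
    ultimately show ?thesis
      unfolding Diff_iff inversions_iff inv comp_apply p_def[symmetric] q_def[symmetric] order
        singleton_iff prod.inject pq[symmetric] by blast
  qed
  then show ?thesis by auto
qed

text \<open>A potential argument. By \<open>step\<close>, a word of length \<open>l\<close> has
  potential at most \<open>u * l\<close>; by \<open>drop\<close>, greedy descent to the identity
  spells \<open>w\<close> by a word attaining this bound, where \<open>invol\<close> recovers
  \<open>w\<close> from its product with \<open>s\<close>.\<close>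

lemma coxeter_length_eqI:
  fixes N :: "'a \<Rightarrow> nat"
  assumes G: "group G" and S: "S \<subseteq> carrier G" and u: "u > 0"
    and one: "N \<one>\<^bsub>G\<^esub> = 0"
    and step: "\<And>w s. w \<in> carrier G \<Longrightarrow> s \<in> S \<Longrightarrow> N (w \<otimes>\<^bsub>G\<^esub> s) \<le> N w + u"
    and invol: "\<And>s. s \<in> S \<Longrightarrow> s \<otimes>\<^bsub>G\<^esub> s = \<one>\<^bsub>G\<^esub>"
    and drop: "\<And>w. w \<in> carrier G \<Longrightarrow> w \<noteq> \<one>\<^bsub>G\<^esub> \<Longrightarrow> \<exists>s\<in>S. N w = N (w \<otimes>\<^bsub>G\<^esub> s) + u"
    and w: "w \<in> carrier G"
  shows "N w = u * coxeter_length G S w"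
proof -
  interpret group G by fact
  let ?word = "\<lambda>ss. foldr (\<lambda>x y. x \<otimes>\<^bsub>G\<^esub> y) ss \<one>\<^bsub>G\<^esub>"
  have closed: "?word ss \<in> carrier G" if "set ss \<subseteq> S" for ss
    using that S by (induction ss) auto
  have snoc: "?word (ss @ [s]) = ?word ss \<otimes>\<^bsub>G\<^esub> s" if "set ss \<subseteq> S" "s \<in> S" for ss s
    using that
  proof (induction ss)
    case Nil
    then show ?case using S by auto
  next
    case (Cons t ss)
    then show ?case using S closed[of ss] by (auto simp: m_assoc subset_iff)
  qed
  have lower: "N (?word ss) \<le> u * length ss" if "set ss \<subseteq> S" for ss
    using that
  proof (induction ss rule: rev_induct)
    case Nil
    then show ?case using one by simp
  next
    case (snoc s ss)
    then have "N (?word (ss @ [s])) \<le> N (?word ss) + u"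
      using step[OF closed, of ss s] \<open>\<And>ss s. _ \<Longrightarrow> _ \<Longrightarrow> ?word (ss @ [s]) = _\<close>[of ss s] by auto
    then show ?case using snoc by auto
  qed
  have "\<exists>ss. set ss \<subseteq> S \<and> ?word ss = w \<and> N w = u * length ss"
    using w
  proof (induction "N w" arbitrary: w rule: less_induct)
    case less
    show ?case
    proof (cases "w = \<one>\<^bsub>G\<^esub>")
      case True
      then show ?thesis using one by (intro exI[of _ "[]"]) auto
    next
      case False
      then obtain s where s: "s \<in> S" "N w = N (w \<otimes>\<^bsub>G\<^esub> s) + u"
        using drop less by blast
      have sc: "s \<in> carrier G" using s S by auto
      obtain ss where ss: "set ss \<subseteq> S" "?word ss = w \<otimes>\<^bsub>G\<^esub> s" "N (w \<otimes>\<^bsub>G\<^esub> s) = u * length ss"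
        using less.hyps[of "w \<otimes>\<^bsub>G\<^esub> s"] s u less.prems sc by auto
      have "?word (ss @ [s]) = w"
        using snoc[OF ss(1) s(1)] ss(2) invol[OF s(1)] less.prems sc by (simp add: m_assoc)
      then show ?thesis
        using ss s by (intro exI[of _ "ss @ [s]"]) auto
    qed
  qed
  then obtain ss where ss: "set ss \<subseteq> S" "?word ss = w" "N w = u * length ss" by blast
  have "coxeter_length G S w = length ss"
    unfolding coxeter_length_def
  proof (rule Least_equality)
    show "\<exists>ss'. set ss' \<subseteq> S \<and> length ss' = length ss \<and> ?word ss' = w" using ss by blast
  next
    fix l assume "\<exists>ss'. set ss' \<subseteq> S \<and> length ss' = l \<and> ?word ss' = w"
    then show "length ss \<le> l" using lower ss u by fastforce
  qed
  then show ?thesis using ss by simp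
qed

section \<open>The pop-stack operator\<close>

text \<open>For \<open>p < q\<close>, the right side expresses that the two positions lie in
  different blocks. A cut between them keeps their order; within one block the reversal subtracts
  from a constant.\<close>

lemma block_rev_same_block_iff:
  assumes w: "w permutes {1..m}" and p: "p \<in> {1..m}" and q: "q \<in> {1..m}" and "p < q"
  shows "block_rev m (ascents m w) p < block_rev m (ascents m w) q \<longleftrightarrow> block_end m (ascents m w) p < q"
proof -
  note C = ascents_subset[of m w]
  show ?thesis
  proof (cases "block_end m (ascents m w) p < q")
    case True
    then obtain c where "c \<in> ascents m w" "p \<le> c" "c < q"
      using not_same_block_cut[OF C \<open>p < q\<close>] q by auto
    then have "block_rev m (ascents m w) p < block_rev m (ascents m w) q"
      using block_rev_le_cut[OF C] cut_less_block_rev[OF C] by (meson le_less_trans)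
    then show ?thesis using True by simp
  next
    case False
    then have "q \<in> {block_start (ascents m w) p..block_end m (ascents m w) p}"
      using block_start_le[of p "ascents m w"] p \<open>p < q\<close> by auto
    from block_same[OF C p this] False show ?thesis
      using p q \<open>p < q\<close> by (auto simp: block_rev_def)
  qed
qed

lemma image_Int_invariant: "(\<And>z. z \<in> D \<Longrightarrow> f z \<in> F \<longleftrightarrow> z \<in> F) \<Longrightarrow> f ` D \<inter> F = f ` (D \<inter> F)"
  by auto

text \<open>
  The common part of the symmetric and the hyperoctahedral groups. The generator \<open>gen i\<close> swaps the
  positions \<open>j\<close> and \<open>j + 1\<close> for all \<open>j \<in> orb i\<close>. Counting the pairs in \<open>F\<close> twice makes the number of
  inversions \<open>u\<close> times the word length: in type A take \<open>F = {}\<close> and \<open>u = 1\<close>, in type B let \<open>F\<close> be the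
  set of pairs of opposite values and \<open>u = 2\<close>.
\<close>

locale pop_system =
  fixes m :: nat and W :: "(nat \<Rightarrow> nat) set" and gen :: "nat \<Rightarrow> nat \<Rightarrow> nat"
    and orb :: "nat \<Rightarrow> nat set" and F :: "(nat \<times> nat) set" and u :: nat
  assumes subgroup_W: "subgroup W (sym_group m)"
    and u_pos: "u > 0"
    and F_invariant: "g \<in> W \<Longrightarrow> (a, b) \<in> F \<Longrightarrow> a \<in> {1..m} \<Longrightarrow> b \<in> {1..m} \<Longrightarrow> (g a, g b) \<in> F"
    and F_sym: "(a, b) \<in> F \<Longrightarrow> (b, a) \<in> F"
    and gen_in: "i \<in> {1..<m} \<Longrightarrow> gen i \<in> W"
    and gen_comp_gen: "i \<in> {1..<m} \<Longrightarrow> gen i \<circ> gen i = id"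
    and gen_apply: "i \<in> {1..<m} \<Longrightarrow> gen i i = Suc i" "i \<in> {1..<m} \<Longrightarrow> gen i (Suc i) = i"
    and weight_gen: "i \<in> {1..<m} \<Longrightarrow>
      card (inversions m (gen i)) + card (inversions m (gen i) \<inter> F) = u"
    and inversions_comp_gen: "w \<in> W \<Longrightarrow> i \<in> {1..<m} \<Longrightarrow> w (Suc i) < w i \<Longrightarrow>
      inversions m (w \<circ> gen i) = inversions m w - (\<lambda>j. (w (Suc j), w j)) ` orb i"
    and orb_self: "i \<in> {1..<m} \<Longrightarrow> i \<in> orb i"
    and orb_descent: "w \<in> W \<Longrightarrow> i \<in> {1..<m} \<Longrightarrow> w (Suc i) < w i \<Longrightarrow> j \<in> orb i \<Longrightarrow>
      j \<in> {1..<m} \<and> w (Suc j) < w j"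
    and block_rev_in_W: "w \<in> W \<Longrightarrow> block_rev m (ascents m w) \<in> W"
begin

abbreviation G :: "(nat \<Rightarrow> nat) monoid" where
  "G \<equiv> sym_group m \<lparr> carrier := W \<rparr>"

abbreviation S :: "(nat \<Rightarrow> nat) set" where
  "S \<equiv> gen ` {1..<m}"

definition weight :: "(nat \<times> nat) set \<Rightarrow> nat" where
  "weight D = card D + card (D \<inter> F)"

lemma group_G: "group G"
  using subgroup_W subgroup.subgroup_is_group sym_group_is_group by blast

lemma permutes_W: "w \<in> W \<Longrightarrow> w permutes {1..m}"
  using subgroup.subset[OF subgroup_W] sym_group_carrier by auto

lemma comp_in_W: "x \<in> W \<Longrightarrow> y \<in> W \<Longrightarrow> x \<circ> y \<in> W"
  using subgroup.m_closed[OF subgroup_W] by (simp add: sym_group_mult)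

lemma id_in_W: "id \<in> W"
  using subgroup.one_closed[OF subgroup_W] by (simp add: sym_group_one)

lemma inv_in_W: "x \<in> W \<Longrightarrow> inv' x \<in> W"
  using subgroup.m_inv_closed[OF subgroup_W] permutes_W sym_group_carrier by fastforce

lemma inv_G: "x \<in> W \<Longrightarrow> inv\<^bsub>G\<^esub> x = inv' x"
  using group.m_inv_consistent[OF sym_group_is_group subgroup_W] permutes_W sym_group_carrier
  by fastforce

declare sym_group_mult [simp] sym_group_one [simp]

lemma weight_Un:
  "finite A \<Longrightarrow> finite B \<Longrightarrow> A \<inter> B = {} \<Longrightarrow> weight (A \<union> B) = weight A + weight B"
  unfolding weight_def Int_Un_distrib2 by (subst (1 2) card_Un_disjoint) auto

lemma weight_Un_le: "weight (A \<union> B) \<le> weight A + weight B"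
  unfolding weight_def Int_Un_distrib2
  using card_Un_le[of A B] card_Un_le[of "A \<inter> F" "B \<inter> F"] by linarith

lemma weight_mono: "A \<subseteq> B \<Longrightarrow> finite B \<Longrightarrow> weight A \<le> weight B"
  unfolding weight_def by (intro add_mono card_mono) auto

lemma weight_split: "finite A \<Longrightarrow> weight A = weight (A \<inter> B) + weight (A - B)"
  by (subst weight_Un[symmetric]) (auto intro: arg_cong[of _ _ weight])

lemma weight_converse: "weight (A\<inverse>) = weight A"
proof -
  have "A\<inverse> \<inter> F = (A \<inter> F)\<inverse>" using F_sym by auto
  then show ?thesis by (simp add: weight_def)
qed

text \<open>Renaming by \<open>g\<close> preserves both counts because \<open>F\<close> is stable
  under \<open>W\<close>. This replaces \<open>inv' x \<circ> y\<close>, whose length enters the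
  weak order, by the disagreements of \<open>x\<close> and \<open>y\<close>.\<close>

lemma weight_disagree_left_mult:
  assumes "g \<in> W" "x \<in> W" "y \<in> W"
  shows "weight (disagree m (g \<circ> x) (g \<circ> y)) = weight (disagree m x y)"
proof -
  let ?D = "disagree m x y"
  have inj: "inj (map_prod g g)"
    using permutes_inj[OF permutes_W[OF assms(1)]] by (simp add: map_prod_inj_on prod.inj_map)
  \<comment> \<open>\<open>F_invariant\<close> is only an implication; the reverse one is its
    instance for \<open>inv' g\<close>.\<close>
  have reflect: "(a, b) \<in> F" if "(g a, g b) \<in> F" "(a, b) \<in> ?D" for a b
  proof -
    have "g a \<in> {1..m}" "g b \<in> {1..m}"
      using that(2) permutes_in_image[OF permutes_W[OF assms(1)]] by (auto simp: disagree_def)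
    then show ?thesis
      using F_invariant[OF inv_in_W[OF assms(1)] that(1)]
      by (simp add: permutes_inverses[OF permutes_W[OF assms(1)]])
  qed
  have preserve: "(g a, g b) \<in> F" if "(a, b) \<in> F" "(a, b) \<in> ?D" for a b
    using F_invariant[OF assms(1) that(1)] that(2) by (simp add: disagree_def)
  have "map_prod g g z \<in> F \<longleftrightarrow> z \<in> F" if "z \<in> ?D" for z
  proof -
    obtain a b where z: "z = (a, b)" by fastforce
    show ?thesis
      using that reflect[of a b] preserve[of a b] unfolding z map_prod_simp by (intro iffI)
  qed
  then have "map_prod g g ` ?D \<inter> F = map_prod g g ` (?D \<inter> F)"
    by (rule image_Int_invariant)
  moreover have "card (map_prod g g ` D) = card D" for D
    by (intro card_image inj_on_subset[OF inj]) simp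
  ultimately show ?thesis
    unfolding weight_def disagree_left_mult[OF assms[THEN permutes_W]] by simp
qed

lemma weight_disagree_gen:
  assumes "w \<in> W" "i \<in> {1..<m}"
  shows "weight (disagree m w (w \<circ> gen i)) = u"
  using weight_disagree_left_mult[OF assms(1) id_in_W gen_in[OF assms(2)]] weight_gen[OF assms(2)]
  by (simp add: weight_def)

text \<open>The triangle inequality from \<open>id\<close> through \<open>w\<close> to
  \<open>w \<circ> gen i\<close>; the second leg has weight \<open>u\<close> by left
  invariance.\<close>

lemma weight_comp_gen_le:
  assumes "w \<in> W" "i \<in> {1..<m}"
  shows "weight (inversions m (w \<circ> gen i)) \<le> weight (inversions m w) + u"
proof -
  have "weight (inversions m (w \<circ> gen i))
      \<le> weight (inversions m w \<union> disagree m w (w \<circ> gen i))"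
    using disagree_triangle[OF permutes_W[OF assms(1)]]
    by (intro weight_mono) (simp_all add: finite_disagree)
  also have "\<dots> \<le> weight (inversions m w) + weight (disagree m w (w \<circ> gen i))"
    by (rule weight_Un_le)
  finally show ?thesis by (simp only: weight_disagree_gen[OF assms])
qed

lemma comp_gen_comp_gen: "i \<in> {1..<m} \<Longrightarrow> w \<circ> gen i \<circ> gen i = w"
  by (simp add: comp_assoc gen_comp_gen)

text \<open>At a descent the inversion set only shrinks, so the disagreement of weight
  \<open>u\<close> consists entirely of lost inversions.\<close>

lemma weight_descent:
  assumes w: "w \<in> W" and i: "i \<in> {1..<m}" and "w (Suc i) < w i"
  shows "weight (inversions m w) = weight (inversions m (w \<circ> gen i)) + u"
proof -
  let ?v = "w \<circ> gen i"
  have v: "?v \<in> W" using comp_in_W w gen_in i by blast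
  have sub: "inversions m ?v \<subseteq> inversions m w"
    using inversions_comp_gen[OF assms] by auto
  then have "disagree m ?v w = inversions m w - inversions m ?v"
    using disagree_eq_inversions[OF permutes_W[OF v] permutes_W[OF w]] by auto
  then have "weight (inversions m w - inversions m ?v) = u"
    using weight_disagree_gen[OF v i] comp_gen_comp_gen[OF i, of w] by simp
  then show ?thesis
    using weight_split[OF finite_disagree, of m id w "inversions m ?v"] sub by (simp add: Int_absorb1)
qed

lemma descent_exists:
  assumes "w \<in> W" "w \<noteq> id"
  obtains i where "i \<in> {1..<m}" "w (Suc i) < w i"
proof -
  have "\<not> (\<forall>i\<in>{1..<m}. w i < w (Suc i))"
    using no_descents_imp_id[OF permutes_W] assms by blast
  moreover have "w i \<noteq> w (Suc i)" for i
    using permutes_inj[OF permutes_W[OF assms(1)]] by (metis injD n_not_Suc_n)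
  ultimately show ?thesis using that by (meson linorder_neqE_nat)
qed

lemma weight_eq_length:
  assumes "w \<in> W"
  shows "weight (inversions m w) = u * coxeter_length G S w"
proof (rule coxeter_length_eqI)
  show "group G" by (rule group_G)
  show "S \<subseteq> carrier G" using gen_in by auto
  show "weight (inversions m \<one>\<^bsub>G\<^esub>) = 0" by (simp add: weight_def)
  fix s assume "s \<in> S"
  then show "s \<otimes>\<^bsub>G\<^esub> s = \<one>\<^bsub>G\<^esub>" using gen_comp_gen by auto
next
  fix w s assume "w \<in> carrier G" "s \<in> S"
  then show "weight (inversions m (w \<otimes>\<^bsub>G\<^esub> s)) \<le> weight (inversions m w) + u"
    using weight_comp_gen_le by auto
next
  fix w assume "w \<in> carrier G" "w \<noteq> \<one>\<^bsub>G\<^esub>"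
  then obtain i where "i \<in> {1..<m}" "w (Suc i) < w i" "w \<in> W"
    using descent_exists by auto
  then show "\<exists>s\<in>S. weight (inversions m w) = weight (inversions m (w \<otimes>\<^bsub>G\<^esub> s)) + u"
    using weight_descent by auto
qed (use u_pos assms in auto)

lemma inversions_empty_iff:
  assumes "w \<in> W"
  shows "inversions m w = {} \<longleftrightarrow> w = id"
proof
  assume empty: "inversions m w = {}"
  show "w = id"
  proof (rule ccontr)
    assume "w \<noteq> id"
    then obtain i where "i \<in> {1..<m}" "w (Suc i) < w i" using descent_exists assms by blast
    then show False using weight_descent[OF assms, of i] empty u_pos by (simp add: weight_def)
  qed
qed simp

text \<open>Left translation by \<open>inv' x\<close> reduces this to the identity being the only
  element without inversions.\<close>

lemma disagree_empty_imp_eq: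
  assumes "x \<in> W" "y \<in> W" "disagree m x y = {}"
  shows "x = y"
proof -
  note x = permutes_W[OF assms(1)]
  have "weight (disagree m (inv' x \<circ> x) (inv' x \<circ> y)) = 0"
    using assms by (subst weight_disagree_left_mult) (auto simp: inv_in_W weight_def)
  then have "inversions m (inv' x \<circ> y) = {}"
    by (simp add: permutes_inv_o[OF x] weight_def finite_disagree)
  then have "inv' x \<circ> y = id"
    using inversions_empty_iff comp_in_W inv_in_W assms by blast
  then have "x \<circ> (inv' x \<circ> y) = x" by simp
  then show ?thesis by (simp add: comp_assoc[symmetric] permutes_inv_o[OF x])
qed

text \<open>Write X and Y for the two inversion sets. By left invariance the length equation says
  that the weights of Y - X, X - Y and X add up to that of Y. Splitting X and Y along their
  intersection leaves twice the weight of X - Y equal to 0, and a finite set of weight 0 is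
  empty.\<close>

lemma le_iff_inversions:
  assumes x: "x \<in> W" and y: "y \<in> W"
  shows "le (right_weak_order G S) x y \<longleftrightarrow> inversions m x \<subseteq> inversions m y"
proof -
  let ?X = "inversions m x" and ?Y = "inversions m y"
  have z: "inv' x \<circ> y \<in> W" using comp_in_W inv_in_W x y by blast
  have fin: "finite ?X" "finite ?Y" by (rule finite_disagree)+
  have "le (right_weak_order G S) x y \<longleftrightarrow>
      coxeter_length G S (inv' x \<circ> y) + coxeter_length G S x = coxeter_length G S y"
    using x by (auto simp: right_weak_order_def inv_G)
  also have "\<dots> \<longleftrightarrow> weight (inversions m (inv' x \<circ> y)) + weight ?X = weight ?Y"
    using u_pos by (simp add: weight_eq_length x y z flip: distrib_left)
  also have "weight (inversions m (inv' x \<circ> y)) = weight (disagree m x y)"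
    using weight_disagree_left_mult[OF inv_in_W[OF x] x y] permutes_inv_o[OF permutes_W[OF x]]
    by simp
  also have "\<dots> = weight (?Y - ?X) + weight ((?X - ?Y)\<inverse>)"
    unfolding disagree_eq_inversions[OF permutes_W[OF x] permutes_W[OF y]]
    by (rule weight_Un) (auto simp: fin inversions_iff)
  also have "(weight (?Y - ?X) + weight ((?X - ?Y)\<inverse>) + weight ?X = weight ?Y) \<longleftrightarrow> weight (?X - ?Y) = 0"
    using weight_split[OF fin(1), of ?Y] weight_split[OF fin(2), of ?X]
    by (auto simp: weight_converse Int_commute)
  also have "\<dots> \<longleftrightarrow> ?X \<subseteq> ?Y"
    using fin by (auto simp: weight_def)
  finally show ?thesis .
qed

lemma comp_gen_descent_iff:
  assumes w: "w \<in> W" and i: "i \<in> {1..<m}"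
  shows "gen i \<in> right_descents G S w \<longleftrightarrow> w (Suc i) < w i"
proof -
  have "coxeter_length G S (w \<circ> gen i) < coxeter_length G S w \<longleftrightarrow>
      weight (inversions m (w \<circ> gen i)) < weight (inversions m w)"
    using u_pos w i comp_in_W gen_in by (simp add: weight_eq_length)
  also have "\<dots> \<longleftrightarrow> w (Suc i) < w i"
  proof (cases "w (Suc i) < w i")
    case True
    then show ?thesis using weight_descent[OF w i True] u_pos by simp
  next
    case False
    moreover have "w i \<noteq> w (Suc i)"
      using permutes_inj[OF permutes_W[OF w]] by (metis injD n_not_Suc_n)
    \<comment> \<open>An ascent of \<open>w\<close> is a descent of \<open>w \<circ> gen i\<close>,
      so \<open>weight_descent\<close> applied there shows that the length goes up.\<close>
    ultimately have "(w \<circ> gen i) (Suc i) < (w \<circ> gen i) i"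
      using gen_apply[OF i] by simp
    then show ?thesis
      using weight_descent[OF comp_in_W[OF w gen_in[OF i]] i] False
      unfolding comp_gen_comp_gen[OF i] by simp
  qed
  finally show ?thesis using i by (auto simp: right_descents_def)
qed

text \<open>Within a run every pair of positions is already inverted, so reversal destroys these
  inversions; between runs the order of positions is kept. Hence nothing new is created and exactly
  the inversions between different runs survive.\<close>

lemma inversions_block_rev:
  assumes w: "w \<in> W"
  shows "(a, b) \<in> inversions m (w \<circ> block_rev m (ascents m w)) \<longleftrightarrow>
    (a, b) \<in> inversions m w \<and> block_end m (ascents m w) (inv' w b) < inv' w a"
proof -
  let ?C = "ascents m w" and ?v = "w \<circ> block_rev m (ascents m w)"
  note pw = permutes_W[OF w] and C = ascents_subset[of m w]
  define p q where "p = inv' w b" and "q = inv' w a"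
  have ab: "a = w q" "b = w p"
    by (simp_all add: p_def q_def permutes_inverses[OF pw])
  have "inv' (block_rev m ?C) = block_rev m ?C"
    by (rule inv_unique_comp) (simp_all add: block_rev_comp_block_rev[OF C])
  then have inv: "inv' ?v = block_rev m ?C \<circ> inv' w"
    using permutes_bij[OF pw] permutes_bij[OF block_rev_permutes[OF C]] o_inv_distrib by metis
  show ?thesis
  proof (cases "a \<in> {1..m} \<and> b \<in> {1..m} \<and> a < b")
    case False
    then show ?thesis by (auto simp: inversions_iff)
  next
    case True
    then have pq: "p \<in> {1..m}" "q \<in> {1..m}"
      unfolding p_def q_def permutes_in_image[OF permutes_inv[OF pw]] by blast+
    have neq: "p \<noteq> q" using True ab by force
    \<comment> \<open>Here \<open>w q < w p\<close> is a non-inversion and must stay one. As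
      \<open>w\<close> decreases along runs, \<open>q\<close> and \<open>p\<close> are in different
      runs.\<close>
    have "\<not> block_rev m ?C p < block_rev m ?C q" if "q < p"
    proof (cases "block_end m ?C q < p")
      case True
      then have "block_rev m ?C q < block_rev m ?C p"
        using block_rev_same_block_iff[OF pw pq(2,1) that] by simp
      then show ?thesis by simp
    next
      case False
      have "w p \<le> w q"
      proof -
        have "r \<le> block_end m ?C q \<Longrightarrow> w r \<le> w q" if "q \<le> r" for r
          using that
        proof (induction r rule: dec_induct)
          case (step r)
          have "r \<notin> ?C"
            using block_end_le_cut[OF C, of r q] step by auto
          moreover have "r \<in> {1..<m}"
            using step pq block_end_le[OF C, of q] by auto
          ultimately show ?case using step by (auto simp: ascents_def)
        qed simp
        then show ?thesis using False that by simp
      qed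
      then show ?thesis using True ab by simp
    qed
    then show ?thesis
      unfolding inversions_iff inv comp_apply p_def[symmetric] q_def[symmetric]
      using block_rev_same_block_iff[OF pw pq(1,2)] neq True by (meson linorder_neqE_nat)
  qed
qed

text \<open>A lower bound of the set misses the inversion at every descent \<open>i\<close>, because
  \<open>w \<circ> gen i\<close> misses it. By transitivity it has no inversion inside a run of
  \<open>w\<close>, and the inversions of \<open>w\<close> between runs are precisely those of
  \<open>?v\<close>.\<close>

theorem pop_eq_block_rev:
  assumes w: "w \<in> W"
  shows "pop G S w = w \<circ> block_rev m (ascents m w)"
proof -
  let ?C = "ascents m w" and ?v = "w \<circ> block_rev m (ascents m w)"
  let ?L = "right_weak_order G S"
  let ?A = "{w \<otimes>\<^bsub>G\<^esub> s | s. s \<in> right_descents G S w} \<union> {w}"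
  note pw = permutes_W[OF w] and C = ascents_subset[of m w]
  have v: "?v \<in> W" using comp_in_W w block_rev_in_W by blast
  have carrier: "carrier ?L = W" by (simp add: right_weak_order_def)
  have A: "?A = insert w ((\<lambda>i. w \<circ> gen i) ` {i \<in> {1..<m}. w (Suc i) < w i})"
    using comp_gen_descent_iff[OF w] by (auto simp: right_descents_def)
  have A_W: "?A \<subseteq> W"
    unfolding A using w comp_in_W gen_in by auto
  have lower_iff: "x \<in> Lower ?L ?A \<longleftrightarrow> x \<in> W \<and> inversions m x \<subseteq> inversions m w \<and>
      (\<forall>i\<in>{1..<m}. w (Suc i) < w i \<longrightarrow> inversions m x \<subseteq> inversions m (w \<circ> gen i))" for x
  proof -
    have "x \<in> Lower ?L ?A \<longleftrightarrow> x \<in> W \<and> (\<forall>y\<in>?A. le ?L x y)"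
      unfolding Lower_def carrier Int_absorb2[OF A_W] by blast
    also have "\<dots> \<longleftrightarrow> x \<in> W \<and> (\<forall>y\<in>?A. inversions m x \<subseteq> inversions m y)"
      using A_W le_iff_inversions[of x] by blast
    finally show ?thesis
      unfolding A by (simp only: ball_simps) blast
  qed
  have v_lower: "?v \<in> Lower ?L ?A"
    unfolding lower_iff
  proof (intro conjI ballI impI)
    show "?v \<in> W" by (rule v)
    show sub: "inversions m ?v \<subseteq> inversions m w"
      using inversions_block_rev[OF w] by auto
    fix i assume i: "i \<in> {1..<m}" and desc: "w (Suc i) < w i"
    have "(w (Suc j), w j) \<notin> inversions m ?v" if "j \<in> orb i" for j
    proof -
      have j: "j \<in> {1..<m}" "w (Suc j) < w j" using orb_descent[OF w i desc that] by auto
      then have "j \<notin> ?C" by (simp add: ascents_def)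
      then have "Suc j \<le> block_end m ?C j"
        using block_Suc[OF C j(1)] block_end_ge[OF C, of "Suc j"] j by simp
      then show ?thesis
        unfolding inversions_block_rev[OF w] by (simp add: permutes_inverses[OF pw])
    qed
    then show "inversions m ?v \<subseteq> inversions m (w \<circ> gen i)"
      unfolding inversions_comp_gen[OF w i desc] using sub by auto
  qed
  have v_greatest: "inversions m x \<subseteq> inversions m ?v" if x_lower: "x \<in> Lower ?L ?A" for x
  proof (rule subrelI)
    fix a b assume ab: "(a, b) \<in> inversions m x"
    have x: "x \<in> W" and sub: "inversions m x \<subseteq> inversions m w"
      and sub': "\<And>i. i \<in> {1..<m} \<Longrightarrow> w (Suc i) < w i \<Longrightarrow> inversions m x \<subseteq> inversions m (w \<circ> gen i)"
      using x_lower unfolding lower_iff by auto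
    define p q where "p = inv' w b" and "q = inv' w a"
    have wpq: "a = w q" "b = w p"
      by (simp_all add: p_def q_def permutes_inverses[OF pw])
    have abw: "(a, b) \<in> inversions m w" using ab sub by auto
    then have pq: "p < q" by (simp add: inversions_iff p_def q_def)
    have pq_in: "p \<in> {1..m}" "q \<in> {1..m}"
      using abw
      unfolding p_def q_def permutes_in_image[OF permutes_inv[OF pw]] inversions_iff by blast+
    have "block_end m ?C p < q"
    proof (rule ccontr)
      assume same: "\<not> block_end m ?C p < q"
      \<comment> \<open>The adjacent comparisons chain up: \<open>x\<close> lists the values of a
        run of \<open>w\<close> in increasing order.\<close>
      have "r \<le> q \<Longrightarrow> inv' x (w r) \<le> inv' x (w p)" if "p \<le> r" for r
        using that
      proof (induction r rule: dec_induct)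
        case (step r)
        have r: "r \<in> {1..<m}" using step pq_in by auto
        have "r \<notin> ?C"
          using block_end_le_cut[OF C, of r p] step same by auto
        then have "w (Suc r) \<le> w r" using r by (auto simp: ascents_def)
        moreover have "w (Suc r) \<noteq> w r"
          using permutes_inj[OF pw] by (metis injD n_not_Suc_n)
        ultimately have desc: "w (Suc r) < w r" by simp
        have "(w (Suc r), w r) \<notin> inversions m (w \<circ> gen r)"
          unfolding inversions_comp_gen[OF w r desc] using orb_self[OF r] by auto
        then have "(w (Suc r), w r) \<notin> inversions m x"
          using sub'[OF r desc] by auto
        moreover have "w (Suc r) \<in> {1..m}" "w r \<in> {1..m}"
          using r permutes_in_image[OF pw] by auto
        ultimately have "inv' x (w (Suc r)) \<le> inv' x (w r)"
          using desc by (simp add: inversions_iff)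
        then show ?case using step by simp
      qed simp
      then have "inv' x a \<le> inv' x b" using pq wpq by simp
      then show False using ab by (simp add: inversions_iff)
    qed
    then show "(a, b) \<in> inversions m ?v"
      unfolding inversions_block_rev[OF w] using abw by (simp add: p_def q_def)
  qed
  define Lo where "Lo = Lower ?L ?A"
  have lower_W: "Lo \<subseteq> W"
    unfolding Lo_def using lower_iff by (intro subsetI) (erule iffD1[THEN conjunct1, rotated])
  note v_lower = v_lower[folded Lo_def] and v_greatest = v_greatest[folded Lo_def]
  have greatest_iff: "greatest ?L g (Lo) \<longleftrightarrow>
      g \<in> Lo \<and> (\<forall>x\<in>Lo. inversions m x \<subseteq> inversions m g)" for g
  proof -
    have "le ?L x g \<longleftrightarrow> inversions m x \<subseteq> inversions m g"
      if "x \<in> Lo" "g \<in> Lo" for x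
      using that lower_W by (intro le_iff_inversions) (erule subsetD, assumption)+
    then show ?thesis unfolding greatest_def carrier using lower_W by blast
  qed
  show ?thesis
    unfolding pop_def inf_def Lo_def[symmetric]
  \<comment> \<open>\<open>inf\<close> selects a greatest lower bound by choice, so uniqueness is
    required: equal inversion sets force equal elements.\<close>
  proof (rule some_equality)
    show "greatest ?L ?v (Lo)"
      unfolding greatest_iff using v_lower v_greatest by blast
    fix g assume "greatest ?L g (Lo)"
    then have g: "g \<in> Lo" "inversions m ?v \<subseteq> inversions m g"
      unfolding greatest_iff using v_lower by blast+
    then have "g \<in> W" "inversions m g = inversions m ?v"
      using v_greatest[OF g(1)] lower_W by blast+
    then show "g = ?v"
      using disagree_empty_imp_eq[OF _ v, of g] disagree_eq_inversions[OF permutes_W permutes_W[OF v], of g]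
      by simp
  qed
qed

end

section \<open>Two-pop-stack-sortable elements and pairs of sets of cuts\<close>

text \<open>
  Both \<open>0\<close> and \<open>n + 1\<close> count as cuts, so \<open>q = 1\<close> and \<open>q = n\<close> have only one candidate neighbour.
\<close>

definition uncut_neighbour :: "nat \<Rightarrow> nat set \<Rightarrow> nat \<Rightarrow> bool" where
  "uncut_neighbour n C q \<longleftrightarrow> q - 1 \<in> {1..n} - C \<or> Suc q \<in> {1..n} - C"

definition good_pairs :: "nat \<Rightarrow> (nat set \<times> nat set) set" where
  "good_pairs n = {(C, E). C \<union> E = {1..n} \<and> (\<forall>q\<in>C - E. uncut_neighbour n C q)}"

lemma good_pairsD:
  assumes "(C, E) \<in> good_pairs (m - 1)"
  shows "C \<subseteq> {1..<m}" "E \<subseteq> {1..<m}" "i \<in> {1..<m} \<Longrightarrow> i \<notin> C \<Longrightarrow> i \<in> E"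
    "q \<in> C \<Longrightarrow> q \<notin> E \<Longrightarrow> q - 1 \<in> {1..<m} - C \<or> Suc q \<in> {1..<m} - C"
proof -
  have eq: "{1..m - 1} = {1..<m}" by auto
  have *: "C \<union> E = {1..<m}" "\<forall>q\<in>C - E. q - 1 \<in> {1..<m} - C \<or> Suc q \<in> {1..<m} - C"
    using assms unfolding good_pairs_def uncut_neighbour_def eq by auto
  show "C \<subseteq> {1..<m}" "E \<subseteq> {1..<m}" using *(1) by blast+
  show "i \<in> {1..<m} \<Longrightarrow> i \<notin> C \<Longrightarrow> i \<in> E" using *(1) by blast
  show "q \<in> C \<Longrightarrow> q \<notin> E \<Longrightarrow> q - 1 \<in> {1..<m} - C \<or> Suc q \<in> {1..<m} - C" using *(2) by blast
qed

lemma ascents_block_rev: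
  assumes C: "C \<subseteq> {1..<m}"
  shows "ascents m (block_rev m C) = C"
proof -
  have "block_rev m C i < block_rev m C (Suc i) \<longleftrightarrow> i \<in> C" if i: "i \<in> {1..<m}" for i
  proof (cases "i \<in> C")
    case True
    then show ?thesis
      using block_rev_le_cut[OF C True order_refl] cut_less_block_rev[OF C True lessI] by simp
  next
    case False
    then show ?thesis using block_rev_Suc(1)[OF C i] by simp
  qed
  then show ?thesis using C unfolding ascents_def by blast
qed

lemma ascents_pair_good:
  assumes w: "w permutes {1..m}"
  shows "(ascents m w, ascents m (w \<circ> block_rev m (ascents m w))) \<in> good_pairs (m - 1)"
proof -
  let ?C = "ascents m w" and ?v = "w \<circ> block_rev m (ascents m w)"
  note C = ascents_subset[of m w]
  have eq: "{1..m - 1} = {1..<m}" by auto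
  have "i \<in> ascents m ?v" if i: "i \<in> {1..<m}" "i \<notin> ?C" for i
  proof -
    define j where "j = block_rev m ?C (Suc i)"
    have j: "block_rev m ?C i = Suc j" "j \<in> {1..<m}" "j \<notin> ?C"
      using block_rev_Suc[OF C i] by (simp_all add: j_def)
    have "w j \<noteq> w (Suc j)"
      using permutes_inj[OF w] by (metis injD n_not_Suc_n)
    then have "w (Suc j) < w j"
      using j(2,3) by (simp add: ascents_def)
    moreover have "?v i = w (Suc j)" "?v (Suc i) = w j" by (simp_all add: j(1) j_def)
    ultimately show ?thesis using i(1) by (simp add: ascents_def[of m ?v])
  qed
  moreover have "q - 1 \<in> {1..<m} - ?C \<or> Suc q \<in> {1..<m} - ?C" if q: "q \<in> ?C" "q \<notin> ascents m ?v" for q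
  proof (rule ccontr)
    assume *: "\<not> ?thesis"
    have qm: "1 \<le> q" "q < m" using q(1) C by auto
    \<comment> \<open>Without an uncut neighbour, both blocks meeting at \<open>q\<close> are
      singletons, so the reversal fixes \<open>q\<close> and \<open>Suc q\<close> and the ascent
      persists.\<close>
    have "q = 1 \<or> q - 1 \<in> ?C" using * qm by auto
    then have "block_start ?C q = q"
      using block_unique(1)[OF C, of q q q] block_end_cut[OF C, of q] qm q(1) by auto
    moreover have "Suc q = m \<or> Suc q \<in> ?C" using * qm by auto
    then have "block_end m ?C (Suc q) = Suc q"
      using block_unique(2)[OF C, of "Suc q" "Suc q" "Suc q"] qm q(1) by auto
    ultimately have "?v q < ?v (Suc q)"
      using block_rev_cut[OF C q(1)] q(1) by (simp add: ascents_def)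
    then show False using q(2) qm by (simp add: ascents_def)
  qed
  ultimately show ?thesis
    unfolding good_pairs_def uncut_neighbour_def eq using C ascents_subset[of m ?v] by blast
qed

lemma ascents_block_rev_comp:
  assumes CE: "(C, E) \<in> good_pairs (m - 1)"
  shows "ascents m (block_rev m E \<circ> block_rev m C) = C"
proof -
  note C = good_pairsD(1)[OF CE] and E = good_pairsD(2)[OF CE]
  let ?w = "block_rev m E \<circ> block_rev m C"
  have "?w i < ?w (Suc i) \<longleftrightarrow> i \<in> C" if i: "i \<in> {1..<m}" for i
  proof (cases "i \<in> C")
    case True
    define p r where "p = block_start C i" and "r = block_end m C (Suc i)"
    have p: "p \<le> i" and r: "Suc i \<le> r"
      using block_start_le[of i C] block_end_ge[OF C, of "Suc i"] i by (auto simp: p_def r_def)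
    \<comment> \<open>\<open>?w\<close> takes the values \<open>block_rev m E p\<close> and
      \<open>block_rev m E r\<close> at \<open>i\<close> and \<open>Suc i\<close>, so a cut of
      \<open>E\<close> between the outer ends \<open>p\<close> and \<open>r\<close> makes it
      increase. If \<open>i\<close> itself is not in \<open>E\<close>, its uncut neighbour is, and
      it lies inside one of the two blocks.\<close>
    have "\<exists>e\<in>E. p \<le> e \<and> e < r"
    proof (cases "i \<in> E")
      case True
      then show ?thesis using p r by (intro bexI[of _ i]) auto
    next
      case False
      then consider "i - 1 \<in> {1..<m} - C" | "Suc i \<in> {1..<m} - C"
        using good_pairsD(4)[OF CE True] by blast
      then show ?thesis
      proof cases
        case 1
        then have "p = block_start C (i - 1)"
          using block_Suc(1)[OF C, of "i - 1"] i by (auto simp: p_def)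
        then have "p \<le> i - 1" using block_start_le[of "i - 1" C] 1 by simp
        moreover have "i - 1 \<in> E" using good_pairsD(3)[OF CE] 1 by blast
        ultimately show ?thesis using r by (intro bexI[of _ "i - 1"]) auto
      next
        case 2
        then have "r = block_end m C (Suc (Suc i))"
          using block_Suc(2)[OF C, of "Suc i"] i by (auto simp: r_def)
        then have "Suc (Suc i) \<le> r" using block_end_ge[OF C, of "Suc (Suc i)"] 2 by simp
        moreover have "Suc i \<in> E" using good_pairsD(3)[OF CE] 2 by blast
        ultimately show ?thesis using p by (intro bexI[of _ "Suc i"]) auto
      qed
    qed
    then have "block_rev m E p < block_rev m E r"
      using block_rev_le_cut[OF E] cut_less_block_rev[OF E] by (meson le_less_trans)
    then show ?thesis
      using block_rev_cut[OF C True] True by (simp add: p_def r_def)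
  next
    case False
    \<comment> \<open>The uncut gap \<open>i\<close> is carried to the uncut gap \<open>j\<close>
      with its sides exchanged. Since \<open>j \<in> E\<close>, \<open>block_rev m E\<close>
      increases across \<open>j\<close>, so the composite decreases at \<open>i\<close>.\<close>
    define j where "j = block_rev m C (Suc i)"
    have j: "block_rev m C i = Suc j" "j \<in> {1..<m}" "j \<notin> C"
      using block_rev_Suc[OF C i False] by (simp_all add: j_def)
    then have "j \<in> E" using good_pairsD(3)[OF CE] by blast
    then have "block_rev m E j < block_rev m E (Suc j)"
      using block_rev_le_cut[OF E _ order_refl] cut_less_block_rev[OF E _ lessI] by (meson le_less_trans)
    then show ?thesis using False j(1) by (simp add: j_def[symmetric])
  qed
  then show ?thesis using C unfolding ascents_def by blast
qed

text \<open>If \<open>Pop w\<close> is sorted by one more step, it equals the reversal for its own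
  ascents \<open>E\<close>, and \<open>w\<close> is that reversal composed with the one for
  \<open>C\<close>. The group shows on the right only in the demand that both reversals lie in
  \<open>W\<close>, which is automatic in type A and means symmetry of the cuts in type B.\<close>

lemma (in pop_system) bij_betw_good_pairs:
  "bij_betw (\<lambda>w. (ascents m w, ascents m (pop G S w))) (pop_stack_sortable 2 G S)
     {(C, E) \<in> good_pairs (m - 1). block_rev m C \<in> W \<and> block_rev m E \<in> W}"
proof -
  have pop_in: "pop G S w \<in> W" if "w \<in> W" for w
    unfolding pop_eq_block_rev[OF that] using that comp_in_W block_rev_in_W by blast
  have sortable_iff: "w \<in> pop_stack_sortable 2 G S \<longleftrightarrow> w \<in> W \<and> pop G S (pop G S w) = id" for w
    by (simp add: pop_stack_sortable_def numeral_2_eq_2)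
  have block_rev_eq: "block_rev m (ascents m w) = w" if "w \<in> W" "pop G S w = id" for w
  proof -
    have "w \<circ> block_rev m (ascents m w) \<circ> block_rev m (ascents m w) = id \<circ> block_rev m (ascents m w)"
      using that pop_eq_block_rev[OF that(1)] by simp
    then show ?thesis
      by (simp add: comp_assoc block_rev_comp_block_rev[OF ascents_subset])
  qed
  have w_eq: "w = pop G S w \<circ> block_rev m (ascents m w)" if "w \<in> W" for w
    unfolding pop_eq_block_rev[OF that]
    by (simp add: comp_assoc block_rev_comp_block_rev[OF ascents_subset])
  show ?thesis
  proof (rule bij_betwI[where g = "\<lambda>(C, E). block_rev m E \<circ> block_rev m C"])
    show "(\<lambda>w. (ascents m w, ascents m (pop G S w))) \<in> pop_stack_sortable 2 G S \<rightarrow>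
        {(C, E) \<in> good_pairs (m - 1). block_rev m C \<in> W \<and> block_rev m E \<in> W}"
    proof
      fix w assume "w \<in> pop_stack_sortable 2 G S"
      then have w: "w \<in> W" using sortable_iff by blast
      then show "(ascents m w, ascents m (pop G S w))
          \<in> {(C, E) \<in> good_pairs (m - 1). block_rev m C \<in> W \<and> block_rev m E \<in> W}"
        using ascents_pair_good[OF permutes_W[OF w], folded pop_eq_block_rev[OF w]]
          block_rev_in_W[OF w] block_rev_in_W[OF pop_in[OF w]] by blast
    qed
    fix w assume "w \<in> pop_stack_sortable 2 G S"
    then have w: "w \<in> W" "pop G S (pop G S w) = id" using sortable_iff by blast+
    then show "(case (ascents m w, ascents m (pop G S w)) of (C, E) \<Rightarrow> block_rev m E \<circ> block_rev m C) = w"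
      using block_rev_eq[OF pop_in] w_eq by simp
  next
    have *: "block_rev m E \<circ> block_rev m C \<in> W"
        "pop G S (block_rev m E \<circ> block_rev m C) = block_rev m E"
        "pop G S (block_rev m E) = id"
      if "(C, E) \<in> good_pairs (m - 1)" "block_rev m C \<in> W" "block_rev m E \<in> W" for C E
    proof -
      show w: "block_rev m E \<circ> block_rev m C \<in> W" using that comp_in_W by blast
      show "pop G S (block_rev m E \<circ> block_rev m C) = block_rev m E"
        unfolding pop_eq_block_rev[OF w] ascents_block_rev_comp[OF that(1)]
        by (simp add: comp_assoc block_rev_comp_block_rev[OF good_pairsD(1)[OF that(1)]])
      show "pop G S (block_rev m E) = id"
        unfolding pop_eq_block_rev[OF that(3)] ascents_block_rev[OF good_pairsD(2)[OF that(1)]]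
        by (rule block_rev_comp_block_rev[OF good_pairsD(2)[OF that(1)]])
    qed
    show "(\<lambda>(C, E). block_rev m E \<circ> block_rev m C)
        \<in> {(C, E) \<in> good_pairs (m - 1). block_rev m C \<in> W \<and> block_rev m E \<in> W} \<rightarrow>
          pop_stack_sortable 2 G S"
    proof
      fix z assume "z \<in> {(C, E) \<in> good_pairs (m - 1). block_rev m C \<in> W \<and> block_rev m E \<in> W}"
      then obtain C E where z: "z = (C, E)" and CE: "(C, E) \<in> good_pairs (m - 1)"
        "block_rev m C \<in> W" "block_rev m E \<in> W" by auto
      show "(case z of (C, E) \<Rightarrow> block_rev m E \<circ> block_rev m C) \<in> pop_stack_sortable 2 G S"
        unfolding sortable_iff z prod.case using * CE by simp
    qed
    fix z assume "z \<in> {(C, E) \<in> good_pairs (m - 1). block_rev m C \<in> W \<and> block_rev m E \<in> W}"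
    then obtain C E where z: "z = (C, E)" and CE: "(C, E) \<in> good_pairs (m - 1)"
        "block_rev m C \<in> W" "block_rev m E \<in> W" by auto
    show "(ascents m (case z of (C, E) \<Rightarrow> block_rev m E \<circ> block_rev m C),
        ascents m (pop G S (case z of (C, E) \<Rightarrow> block_rev m E \<circ> block_rev m C))) = z"
      using *(2)[OF CE] ascents_block_rev_comp[OF CE(1)] ascents_block_rev[OF good_pairsD(2)[OF CE(1)]]
      by (simp add: z)
  qed
qed

section \<open>Descending runs and ascents\<close>

lemma strict_antimono_on_block_iff:
  assumes w: "w permutes {1..m}" and ab: "1 \<le> a" "b \<le> m"
  shows "strict_antimono_on {a..b} w \<longleftrightarrow> {a..<b} \<inter> ascents m w = {}"
proof
  assume anti: "strict_antimono_on {a..b} w"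
  have "i \<notin> ascents m w" if "i \<in> {a..<b}" for i
    using monotone_onD[OF anti, of i "Suc i"] that by (auto simp: ascents_def)
  then show "{a..<b} \<inter> ascents m w = {}" by blast
next
  assume *: "{a..<b} \<inter> ascents m w = {}"
  have desc: "w (Suc i) < w i" if "i \<in> {a..<b}" for i
  proof -
    have "\<not> w i < w (Suc i)" using * that ab by (auto simp: ascents_def)
    moreover have "w i \<noteq> w (Suc i)"
      using permutes_inj[OF w] by (metis injD n_not_Suc_n)
    ultimately show ?thesis by simp
  qed
  show "strict_antimono_on {a..b} w"
  proof (rule monotone_onI)
    fix i j assume i: "i \<in> {a..b}" and j: "j \<in> {a..b}" and "i < j"
    from \<open>i < j\<close> have "Suc i \<le> j" by simp
    then have "j \<le> b \<Longrightarrow> w j < w i"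
    proof (induction j rule: dec_induct)
      case base
      then show ?case using desc[of i] i by simp
    next
      case (step k)
      then show ?case using desc[of k] i by simp
    qed
    then show "w j < w i" using j by simp
  qed
qed

text \<open>Runs are indexed by their last positions: the ascents, and \<open>m\<close>, which
  accounts for the additional one.\<close>

lemma card_descending_runs:
  assumes w: "w permutes {1..m}" and m: "1 \<le> m"
  shows "card (descending_runs m w) = Suc (card (ascents m w))"
proof -
  let ?C = "ascents m w"
  note C = ascents_subset[of m w]
  let ?run = "\<lambda>b. {block_start ?C b..b}"
  have block_iff: "decreasing_block m w A \<longleftrightarrow>
      (\<exists>a b. 1 \<le> a \<and> a \<le> b \<and> b \<le> m \<and> A = {a..b} \<and> {a..<b} \<inter> ?C = {})" for A
    unfolding decreasing_block_def using strict_antimono_on_block_iff[OF w] by blast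
  have run: "block_end m ?C b = b" if "b \<in> insert m ?C" for b
    using that
  proof
    assume "b = m"
    then show ?thesis using block_end_le[OF C, of b] block_end_ge[OF C, of b] by simp
  qed (rule block_cut(1)[OF C])
  have "descending_runs m w = ?run ` insert m ?C"
  proof (intro equalityI subsetI)
    fix A assume "A \<in> descending_runs m w"
    then have A: "decreasing_block m w A" and max: "\<And>B. decreasing_block m w B \<Longrightarrow> A \<subseteq> B \<Longrightarrow> B = A"
      by (auto simp: descending_runs_def)
    obtain a b where ab: "1 \<le> a" "a \<le> b" "b \<le> m" "A = {a..b}" "{a..<b} \<inter> ?C = {}"
      using A unfolding block_iff by (elim exE conjE)
    have b: "b \<in> insert m ?C"
    proof (rule ccontr)
      assume "b \<notin> insert m ?C"
      then have "decreasing_block m w {a..Suc b}"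
        unfolding block_iff using ab
        by (intro exI[of _ a] exI[of _ "Suc b"]) (auto simp: less_Suc_eq)
      then have "{a..Suc b} = {a..b}" using max[of "{a..Suc b}"] ab by auto
      then show False using ab(2) by (simp)
    qed
    have "a = 1 \<or> a - 1 \<in> ?C"
    proof (rule ccontr)
      assume *: "\<not> ?thesis"
      have "{a - 1..<b} \<subseteq> insert (a - 1) {a..<b}" by auto
      then have "{a - 1..<b} \<inter> ?C = {}" using ab(5) * by blast
      then have "decreasing_block m w {a - 1..b}"
        unfolding block_iff using ab *
        by (intro exI[of _ "a - 1"] exI[of _ b]) auto
      then have "{a - 1..b} = {a..b}" using max[of "{a - 1..b}"] ab by auto
      then show False using ab(1,2) * by (auto)
    qed
    then have "block_start ?C b = a"
      using block_unique(1)[OF C ab(1,2) order_refl ab(3), of] ab(5) b by (auto simp: disjoint_iff)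
    then show "A \<in> ?run ` insert m ?C" using ab(4) b by blast
  next
    fix A assume "A \<in> ?run ` insert m ?C"
    then obtain b where b: "b \<in> insert m ?C" and A: "A = {block_start ?C b..b}" by blast
    define a where "a = block_start ?C b"
    have ab: "1 \<le> a" "a \<le> b" "b \<le> m"
      using block_start_pos[of ?C b] block_start_le[of b ?C] b C m by (auto simp: a_def)
    have no_cut: "{a..<b} \<inter> ?C = {}"
      using no_cut_in_block[OF C, of b] run[OF b] ab by (auto simp: a_def)
    have dec: "decreasing_block m w A"
      unfolding block_iff using ab no_cut by (intro exI conjI) (simp_all add: A a_def)
    have "B = A" if B: "decreasing_block m w B" "A \<subseteq> B" for B
    proof -
      obtain a' b' where ab': "1 \<le> a'" "a' \<le> b'" "b' \<le> m" "B = {a'..b'}" "{a'..<b'} \<inter> ?C = {}"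
        using B(1) unfolding block_iff by (elim exE conjE)
      have le: "a' \<le> a" "b \<le> b'" using B(2) ab ab' by (auto simp: A a_def[symmetric])
      have "b = b'"
      proof (rule ccontr)
        assume "b \<noteq> b'"
        then have "b \<in> {a'..<b'}" "b \<noteq> m" using le ab ab' by auto
        then show False using b ab'(5) by blast
      qed
      moreover have "a' = a"
      proof (rule ccontr)
        assume "a' \<noteq> a"
        then have "a - 1 \<in> {a'..<b'}" using le ab ab' by auto
        moreover have "a - 1 \<in> ?C"
          using block_start_cut[of ?C b] \<open>a' \<noteq> a\<close> le ab' by (auto simp: a_def)
        ultimately show False using ab'(5) by blast
      qed
      ultimately show ?thesis unfolding A ab'(4) a_def by simp
    qed
    then show "A \<in> descending_runs m w" using dec by (simp add: descending_runs_def)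
  qed
  moreover have "inj_on ?run (insert m ?C)"
  proof (rule inj_onI)
    fix b b' assume "b \<in> insert m ?C" "b' \<in> insert m ?C" "?run b = ?run b'"
    moreover have "1 \<le> b" "1 \<le> b'" using calculation C m by auto
    ultimately show "b = b'"
      using block_start_le[of b ?C] by (simp)
  qed
  moreover have "m \<notin> ?C" using C by auto
  ultimately show ?thesis
    using finite_cuts[OF C] by (simp add: card_image)
qed

section \<open>Counting the pairs\<close>

text \<open>
  \<open>good_pairs_open n\<close> consists of the pairs which become good when \<open>n + 1\<close> is added to \<open>E\<close> only.
\<close>

definition good_pairs_open :: "nat \<Rightarrow> (nat set \<times> nat set) set" where
  "good_pairs_open n =
     {(C, E). C \<union> E = {1..n} \<and> (\<forall>q\<in>C - E. uncut_neighbour n C q \<or> q = n)}"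

lemma finite_pairs: "finite {(C, E). C \<union> E = {1..n::nat}}"
  by (rule finite_subset[of _ "Pow {1..n} \<times> Pow {1..n}"]) auto

lemma card_Int_Un3:
  assumes "finite A" "X \<inter> Y = {}" "X \<inter> Z = {}" "Y \<inter> Z = {}"
  shows "card ((A \<inter> X) \<union> (A \<inter> Y) \<union> (A \<inter> Z)) = card (A \<inter> X) + card (A \<inter> Y) + card (A \<inter> Z)"
proof -
  have "((A \<inter> X) \<union> (A \<inter> Y)) \<inter> (A \<inter> Z) = {}" "(A \<inter> X) \<inter> (A \<inter> Y) = {}"
    using assms by blast+
  then show ?thesis using assms(1) by (simp add: card_Un_disjoint)
qed

text \<open>The top gap \<open>Suc n\<close> belongs to \<open>E\<close> only, to both sets, or to
  \<open>C\<close> only; deleting it yields \<open>P\<close>, \<open>Q\<close> and \<open>R\<close>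
  respectively.\<close>

lemma card_pairs_Suc:
  fixes A P Q R :: "(nat set \<times> nat set) set"
  assumes A: "A \<subseteq> {(C, E). C \<union> E = {1..Suc n}}"
    and P: "P \<subseteq> {(C, E). C \<union> E = {1..n}}"
      "\<And>C E. C \<union> E = {1..n} \<Longrightarrow> (C, insert (Suc n) E) \<in> A \<longleftrightarrow> (C, E) \<in> P"
    and Q: "Q \<subseteq> {(C, E). C \<union> E = {1..n}}"
      "\<And>C E. C \<union> E = {1..n} \<Longrightarrow> (insert (Suc n) C, insert (Suc n) E) \<in> A \<longleftrightarrow> (C, E) \<in> Q"
    and R: "R \<subseteq> {(C, E). C \<union> E = {1..n}}"
      "\<And>C E. C \<union> E = {1..n} \<Longrightarrow> (insert (Suc n) C, E) \<in> A \<longleftrightarrow> (C, E) \<in> R"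
  shows "card A = card P + card Q + card R"
proof -
  let ?U = "{(C, E). C \<union> E = {1..n}}"
  let ?f = "\<lambda>(C, E). (C, insert (Suc n) E)"
    and ?g = "\<lambda>(C, E). (insert (Suc n) C, insert (Suc n) E)"
    and ?h = "\<lambda>(C, E). (insert (Suc n) C, E)"
  have "Suc n \<notin> C \<union> E" if "(C, E) \<in> ?U" for C E
    using that by simp
  then have notin: "Suc n \<notin> C" "Suc n \<notin> E" if "(C, E) \<in> ?U" for C E
    using that by blast+
  have inj: "inj_on ?f ?U" "inj_on ?g ?U" "inj_on ?h ?U"
    using notin by (auto simp: inj_on_def insert_ident)
  have count: "card {z \<in> ?U. F z \<in> A} = card (A \<inter> F ` ?U)"
    if "inj_on F ?U" for F :: "nat set \<times> nat set \<Rightarrow> nat set \<times> nat set"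
  proof -
    have "A \<inter> F ` ?U = F ` {z \<in> ?U. F z \<in> A}" by auto
    moreover have "inj_on F {z \<in> ?U. F z \<in> A}"
      by (rule inj_on_subset[OF that]) blast
    ultimately show ?thesis by (simp only: card_image)
  qed
  have preimage: "{z \<in> ?U. F z \<in> A} = B"
    if "B \<subseteq> ?U" "\<And>C E. (C, E) \<in> ?U \<Longrightarrow> F (C, E) \<in> A \<longleftrightarrow> (C, E) \<in> B" for F B
  proof (rule Set.set_eqI)
    fix z :: "nat set \<times> nat set"
    obtain C E where z: "z = (C, E)" by fastforce
    show "z \<in> {z \<in> ?U. F z \<in> A} \<longleftrightarrow> z \<in> B"
      using that(1) that(2)[of C E] unfolding z by blast
  qed
  have "z \<in> ?f ` ?U \<union> ?g ` ?U \<union> ?h ` ?U" if "z \<in> A" for z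
  proof -
    obtain C E where z: "z = (C, E)" by fastforce
    have CE: "C \<union> E = {1..Suc n}" using that A unfolding z by blast
    let ?C = "C - {Suc n}" and ?E = "E - {Suc n}"
    have "?C \<union> ?E = {1..Suc n} - {Suc n}" unfolding CE[symmetric] by blast
    also have "\<dots> = {1..n}" by auto
    finally have U: "(?C, ?E) \<in> ?U" by simp
    have "Suc n \<in> C \<union> E" unfolding CE by simp
    then have "Suc n \<in> C \<or> Suc n \<in> E" by simp
    then have "z = ?f (?C, ?E) \<or> z = ?g (?C, ?E) \<or> z = ?h (?C, ?E)"
      by (auto simp: z insert_absorb)
    then show ?thesis using U by blast
  qed
  then have "A = (A \<inter> ?f ` ?U) \<union> (A \<inter> ?g ` ?U) \<union> (A \<inter> ?h ` ?U)" by blast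
  moreover have fin: "finite A" using A finite_pairs finite_subset by blast
  moreover have "z \<in> ?f ` ?U \<Longrightarrow> Suc n \<notin> fst z \<and> Suc n \<in> snd z"
      "z \<in> ?g ` ?U \<Longrightarrow> Suc n \<in> fst z \<and> Suc n \<in> snd z"
      "z \<in> ?h ` ?U \<Longrightarrow> Suc n \<in> fst z \<and> Suc n \<notin> snd z" for z
    using notin by (elim imageE; clarsimp)+
  then have "?f ` ?U \<inter> ?g ` ?U = {}" "?f ` ?U \<inter> ?h ` ?U = {}" "?g ` ?U \<inter> ?h ` ?U = {}"
    by (intro equals0I; elim IntE; blast)+
  then have "card ((A \<inter> ?f ` ?U) \<union> (A \<inter> ?g ` ?U) \<union> (A \<inter> ?h ` ?U))
      = card (A \<inter> ?f ` ?U) + card (A \<inter> ?g ` ?U) + card (A \<inter> ?h ` ?U)"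
    by (rule card_Int_Un3[OF fin])
  ultimately have "card A = card (A \<inter> ?f ` ?U) + card (A \<inter> ?g ` ?U) + card (A \<inter> ?h ` ?U)"
    by simp
  also have "\<dots> = card {z \<in> ?U. ?f z \<in> A} + card {z \<in> ?U. ?g z \<in> A} + card {z \<in> ?U. ?h z \<in> A}"
    by (simp only: count[OF inj(1)] count[OF inj(2)] count[OF inj(3)])
  also have "{z \<in> ?U. ?f z \<in> A} = P"
    by (rule preimage[OF P(1)]) (simp only: P(2) mem_Collect_eq prod.case)
  also have "{z \<in> ?U. ?g z \<in> A} = Q"
    by (rule preimage[OF Q(1)]) (simp only: Q(2) mem_Collect_eq prod.case)
  also have "{z \<in> ?U. ?h z \<in> A} = R"
    by (rule preimage[OF R(1)]) (simp only: R(2) mem_Collect_eq prod.case)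
  finally show ?thesis .
qed

text \<open>An uncut gap \<open>Suc n\<close> helps the gap \<open>n\<close> alone; a cut one helps
  nothing below it.\<close>

lemma uncut_neighbour_Suc:
  "q \<in> {1..n} \<Longrightarrow> Suc n \<notin> C \<Longrightarrow> uncut_neighbour (Suc n) C q \<longleftrightarrow> uncut_neighbour n C q \<or> q = n"
  "q \<in> {1..n} \<Longrightarrow> uncut_neighbour (Suc n) (insert (Suc n) C) q \<longleftrightarrow> uncut_neighbour n C q"
  "uncut_neighbour (Suc n) (insert (Suc n) C) (Suc n) \<longleftrightarrow> n \<in> {1..n} - C"
  by (auto simp: uncut_neighbour_def)

context
  fixes n :: nat and C E :: "nat set"
  assumes CE: "C \<union> E = {1..n}"
begin

lemma pair_Suc:
  "Suc n \<notin> C" "Suc n \<notin> E" "q \<in> C \<Longrightarrow> q \<in> {1..n}"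
  "C \<union> insert (Suc n) E = {1..Suc n}" "insert (Suc n) C \<union> E = {1..Suc n}"
  "insert (Suc n) C \<union> insert (Suc n) E = {1..Suc n}"
proof -
  have "Suc n \<notin> C \<union> E" unfolding CE by simp
  then show "Suc n \<notin> C" "Suc n \<notin> E" by blast+
  show "q \<in> C \<Longrightarrow> q \<in> {1..n}" using CE by blast
  have "insert (Suc n) (C \<union> E) = {1..Suc n}" unfolding CE by auto
  then show "C \<union> insert (Suc n) E = {1..Suc n}" "insert (Suc n) C \<union> E = {1..Suc n}"
    "insert (Suc n) C \<union> insert (Suc n) E = {1..Suc n}"
    unfolding Un_insert_left Un_insert_right insert_absorb2 by - assumption+
qed

lemma pair_Diff:
  "C - insert (Suc n) E = C - E" "insert (Suc n) C - insert (Suc n) E = C - E"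
  "insert (Suc n) C - E = insert (Suc n) (C - E)"
  using pair_Suc by blast+

lemma pair_uncut:
  assumes "q \<in> C - E"
  shows "uncut_neighbour (Suc n) C q \<longleftrightarrow> uncut_neighbour n C q \<or> q = n"
    "uncut_neighbour (Suc n) (insert (Suc n) C) q \<longleftrightarrow> uncut_neighbour n C q" "q \<noteq> Suc n"
proof -
  have q: "q \<in> {1..n}" using assms pair_Suc(3) by blast
  show "uncut_neighbour (Suc n) C q \<longleftrightarrow> uncut_neighbour n C q \<or> q = n"
    by (rule uncut_neighbour_Suc(1)[OF q pair_Suc(1)])
  show "uncut_neighbour (Suc n) (insert (Suc n) C) q \<longleftrightarrow> uncut_neighbour n C q"
    by (rule uncut_neighbour_Suc(2)[OF q])
  show "q \<noteq> Suc n" using q by simp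
qed

text \<open>In the first case \<open>Suc n\<close> is uncut and excuses \<open>n\<close>. In the
  third, \<open>Suc n\<close> itself needs an uncut neighbour, which can only be \<open>n\<close>;
  then \<open>n \<notin> C\<close>, so being open and being good agree, and the open form is the one
  counted by \<open>card_good_pairs_open_uncut\<close>.\<close>

lemma good_pairs_Suc:
  "(C, insert (Suc n) E) \<in> good_pairs (Suc n) \<longleftrightarrow> (C, E) \<in> good_pairs_open n"
  "(insert (Suc n) C, insert (Suc n) E) \<in> good_pairs (Suc n) \<longleftrightarrow> (C, E) \<in> good_pairs n"
  "(insert (Suc n) C, E) \<in> good_pairs (Suc n) \<longleftrightarrow> (C, E) \<in> good_pairs_open n \<and> n \<in> {1..n} - C"
  unfolding good_pairs_def good_pairs_open_def mem_Collect_eq prod.case pair_Diff pair_Suc(4-6) CE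
    ball_simps(7) uncut_neighbour_Suc(3)
  using pair_uncut by blast+

text \<open>In the third case \<open>Suc n\<close> is the exempt gap, and being cut it excuses
  nothing below, so the remaining pair has to be good outright.\<close>

lemma good_pairs_open_Suc:
  "(C, insert (Suc n) E) \<in> good_pairs_open (Suc n) \<longleftrightarrow> (C, E) \<in> good_pairs_open n"
  "(insert (Suc n) C, insert (Suc n) E) \<in> good_pairs_open (Suc n) \<longleftrightarrow> (C, E) \<in> good_pairs n"
  "(insert (Suc n) C, E) \<in> good_pairs_open (Suc n) \<longleftrightarrow> (C, E) \<in> good_pairs n"
  unfolding good_pairs_def good_pairs_open_def mem_Collect_eq prod.case pair_Diff pair_Suc(4-6) CE
    ball_simps(7)
  using pair_uncut by blast+

end

lemma good_pairs_subset:
  "good_pairs n \<subseteq> {(C, E). C \<union> E = {1..n}}" "good_pairs_open n \<subseteq> {(C, E). C \<union> E = {1..n}}"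
  unfolding good_pairs_def good_pairs_open_def by blast+

lemma card_good_pairs_Suc:
  "card (good_pairs (Suc n)) = card (good_pairs_open n) + card (good_pairs n)
    + card {(C, E) \<in> good_pairs_open n. n \<in> {1..n} - C}"
proof (rule card_pairs_Suc)
  show "{(C, E) \<in> good_pairs_open n. n \<in> {1..n} - C} \<subseteq> {(C, E). C \<union> E = {1..n}}"
    using good_pairs_subset(2)[of n] by blast
  show "(insert (Suc n) C, E) \<in> good_pairs (Suc n) \<longleftrightarrow>
      (C, E) \<in> {(C, E) \<in> good_pairs_open n. n \<in> {1..n} - C}" if "C \<union> E = {1..n}" for C E
    using good_pairs_Suc(3)[OF that] by simp
qed (fact good_pairs_subset good_pairs_Suc(1,2))+

lemma card_good_pairs_open_Suc:
  "card (good_pairs_open (Suc n)) = card (good_pairs_open n) + 2 * card (good_pairs n)"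
proof -
  have "card (good_pairs_open (Suc n)) = card (good_pairs_open n) + card (good_pairs n) + card (good_pairs n)"
    by (rule card_pairs_Suc) (fact good_pairs_subset good_pairs_open_Suc)+
  then show ?thesis by simp
qed

text \<open>A gap outside \<open>C\<close> lies in \<open>E\<close> only, so two of the three cases
  for the top gap are empty.\<close>

lemma card_good_pairs_open_uncut:
  "card {(C, E) \<in> good_pairs_open (Suc n). Suc n \<in> {1..Suc n} - C} = card (good_pairs_open n)"
proof -
  let ?A = "{(C, E) \<in> good_pairs_open (Suc n). Suc n \<in> {1..Suc n} - C}"
  have "card ?A = card (good_pairs_open n) + card ({} :: (nat set \<times> nat set) set)
      + card ({} :: (nat set \<times> nat set) set)"
  proof (rule card_pairs_Suc)
    show "?A \<subseteq> {(C, E). C \<union> E = {1..Suc n}}"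
      using good_pairs_subset(2)[of "Suc n"] by blast
    show "(C, insert (Suc n) E) \<in> ?A \<longleftrightarrow> (C, E) \<in> good_pairs_open n" if "C \<union> E = {1..n}" for C E
      using good_pairs_open_Suc(1)[OF that] pair_Suc(1)[OF that] by simp
  qed (use good_pairs_subset in simp_all)
  then show ?thesis by simp
qed

lemma card_good_pairs_0: "card (good_pairs 0) = 1" "card (good_pairs_open 0) = 1"
proof -
  have "good_pairs 0 = {({}, {})}" "good_pairs_open 0 = {({}, {})}"
    by (auto simp: good_pairs_def good_pairs_open_def)
  then show "card (good_pairs 0) = 1" "card (good_pairs_open 0) = 1" by simp_all
qed

lemma card_good_pairs_small: "card (good_pairs (Suc 0)) = 2" "card (good_pairs (Suc (Suc 0))) = 6"
proof -
  show "card (good_pairs (Suc 0)) = 2"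
    using card_good_pairs_Suc[of 0] by (simp add: card_good_pairs_0)
  then show "card (good_pairs (Suc (Suc 0))) = 6"
    using card_good_pairs_Suc[of "Suc 0"]
    unfolding card_good_pairs_open_uncut card_good_pairs_open_Suc card_good_pairs_0 by simp
qed

text \<open>With a for the good and b for the open counts, a(k+2) = b(k+1) + a(k+1) + b(k) and
  b(k+1) = b(k) + 2 a(k). Expanding b(n+2) and b(n+1) in a(n+3) and using the first equation for k =
  n eliminates b.\<close>

lemma card_good_pairs_rec:
  "card (good_pairs (n + 3)) = 2 * card (good_pairs (n + 2)) + card (good_pairs (n + 1)) + 2 * card (good_pairs n)"
proof -
  have rec: "card (good_pairs (Suc (Suc k))) =
      card (good_pairs_open (Suc k)) + card (good_pairs (Suc k)) + card (good_pairs_open k)" for k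
    using card_good_pairs_Suc[of "Suc k"] card_good_pairs_open_uncut[of k] by simp
  have shift: "n + 3 = Suc (Suc (Suc n))" "n + 2 = Suc (Suc n)" "n + 1 = Suc n" by simp_all
  show ?thesis
    unfolding shift rec card_good_pairs_open_Suc by simp
qed

section \<open>The generating function\<close>

unbundle fps_syntax

lemma good_pairs_fps:
  fixes f :: "rat fps"
  assumes f: "\<And>n. f $ n = (if n \<ge> 1 then of_nat (card (good_pairs n)) else 0)"
  shows "f = 2 * fps_X * (1 + fps_X + fps_X ^ 2) / (1 - 2 * fps_X - fps_X ^ 2 - 2 * fps_X ^ 3)"
proof -
  let ?N = "2 * fps_X * (1 + fps_X + fps_X ^ 2) :: rat fps"
    and ?D = "1 - 2 * fps_X - fps_X ^ 2 - 2 * fps_X ^ 3 :: rat fps"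
  have D: "?D * f = f - 2 * (fps_X ^ 1 * f) - fps_X ^ 2 * f - 2 * (fps_X ^ 3 * f)"
    by (simp add: algebra_simps)
  have N: "?N = 2 * fps_X ^ 1 + 2 * fps_X ^ 2 + 2 * fps_X ^ 3"
    by (simp add: algebra_simps power2_eq_square power3_eq_cube)
  have two: "(2 * g) $ n = 2 * g $ n" for g :: "rat fps" and n
    by (simp add: numeral_fps_const)
  note coeff = fps_sub_nth fps_add_nth two fps_X_power_mult_nth fps_X_power_nth
  have "?D * f = ?N"
  proof (rule fps_ext)
    fix n
    \<comment> \<open>\<open>f\<close> lacks the constant term
      \<open>card (good_pairs 0) = 1\<close>, so the recurrence holds for its coefficients only from
      index 4 on. At 1, 2, 3 the product has coefficients 2, 6 - 2 * 2 and the missing 2 * 1, which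
      are those of the numerator.\<close>
    consider "n = 0" | "n = 1" | "n = 2" | "n = 3" | k where "n = Suc k + 3"
      by (metis One_nat_def Suc_1 add.commute add_Suc_right add_cancel_right_left not0_implies_Suc numeral_3_eq_3)
    then show "(?D * f) $ n = ?N $ n"
    proof cases
      case (5 k)
      then show ?thesis
        unfolding D N coeff f
        using card_good_pairs_rec[of "Suc k"] by (simp add: algebra_simps eval_nat_numeral)
    next
      case 1
      show ?thesis unfolding 1 D N coeff f by simp
    next
      case 2
      show ?thesis unfolding 2 D N coeff f by (simp add: card_good_pairs_small)
    next
      case 3
      show ?thesis unfolding 3 D N coeff f by (simp add: card_good_pairs_small numeral_2_eq_2)
    next
      case 4
      show ?thesis unfolding 4 D N coeff f
        using card_good_pairs_rec[of 0] by (simp add: card_good_pairs_small numeral_2_eq_2 card_good_pairs_0)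
    qed
  qed
  moreover have "?D $ 0 = 1" by simp
  then have "?D \<noteq> 0" by (metis fps_zero_nth zero_neq_one)
  ultimately show ?thesis by (metis nonzero_mult_div_cancel_left)
qed

section \<open>The symmetric group\<close>

lemma inv_adj: "inv' (adj i) = adj i"
  by (rule inv_unique_comp) simp_all

text \<open>Multiplying \<open>adj i\<close> by itself removes only the pair
  \<open>(i, Suc i)\<close> from its inversions and leaves those of \<open>id\<close>, which are
  none.\<close>

lemma inversions_adj:
  assumes "i \<in> {1..<m}"
  shows "inversions m (adj i) = {(i, Suc i)}"
proof -
  have "inversions m (adj i \<circ> adj i) = inversions m (adj i) - {(i, Suc i)}"
    using inversions_comp_adj[OF adj_permutes[OF assms] assms] by (simp add: adj_apply)
  then have "inversions m (adj i) \<subseteq> {(i, Suc i)}" by auto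
  moreover have "(i, Suc i) \<in> inversions m (adj i)"
    using assms by (auto simp: inversions_iff inv_adj adj_apply)
  ultimately show ?thesis by blast
qed

lemma pop_system_sym: "pop_system m (carrier (sym_group m)) adj (\<lambda>i. {i}) {} 1"
proof (rule pop_system.intro)
  show "subgroup (carrier (sym_group m)) (sym_group m)"
    by (rule group.subgroup_self[OF sym_group_is_group])
  show "block_rev m (ascents m w) \<in> carrier (sym_group m)" for w
    unfolding sym_group_carrier by (rule block_rev_permutes[OF ascents_subset])
  show "inversions m (w \<circ> adj i) = inversions m w - (\<lambda>j. (w (Suc j), w j)) ` {i}"
    if "w \<in> carrier (sym_group m)" "i \<in> {1..<m}" "w (Suc i) < w i" for w i
    using inversions_comp_adj that by (simp add: sym_group_carrier)
  show "card (inversions m (adj i)) + card (inversions m (adj i) \<inter> {}) = 1" if "i \<in> {1..<m}" for i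
    using inversions_adj[OF that] by simp
  show "adj i \<in> carrier (sym_group m)" if "i \<in> {1..<m}" for i
    using adj_permutes[OF that] by (simp add: sym_group_carrier)
qed (auto simp: adj_apply)

lemma pop_sortable_S_eq:
  "pop_sortable_S t m = pop_stack_sortable t (sym_group m\<lparr>carrier := carrier (sym_group m)\<rparr>) (adj ` {1..<m})"
proof -
  have "{1..m - 1} = {1..<m}" by auto
  then have "sym_gens m = adj ` {1..<m}"
    unfolding sym_gens_def by blast
  then show ?thesis by simp
qed

lemma ex_bij_betw_pop_sortable_S:
  obtains \<Phi> where "bij_betw \<Phi> (pop_sortable_S 2 (n + 1)) (good_pairs n)"
    "\<And>w. w \<in> pop_sortable_S 2 (n + 1) \<Longrightarrow> card (descending_runs (n + 1) w) = card (fst (\<Phi> w)) + 1"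
proof -
  interpret pop_system "n + 1" "carrier (sym_group (n + 1))" adj "\<lambda>i. {i}" "{}" 1
    by (rule pop_system_sym)
  let ?\<Phi> = "\<lambda>w. (ascents (n + 1) w, ascents (n + 1) (pop G S w))"
  have eq: "{(C, E) \<in> good_pairs (n + 1 - 1). block_rev (n + 1) C \<in> carrier (sym_group (n + 1)) \<and>
      block_rev (n + 1) E \<in> carrier (sym_group (n + 1))} = good_pairs n"
    using good_pairsD(1,2)[of _ _ "n + 1"] block_rev_permutes by (auto simp: sym_group_carrier)
  have "bij_betw ?\<Phi> (pop_sortable_S 2 (n + 1)) (good_pairs n)"
    using bij_betw_good_pairs unfolding pop_sortable_S_eq eq .
  moreover have "card (descending_runs (n + 1) w) = card (fst (?\<Phi> w)) + 1"
    if "w \<in> pop_sortable_S 2 (n + 1)" for w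
    using card_descending_runs[of w "n + 1"] that
    by (simp add: pop_stack_sortable_def sym_group_carrier)
  ultimately show ?thesis by (rule that)
qed

section \<open>The hyperoctahedral group\<close>

definition hyperoctahedral :: "nat \<Rightarrow> (nat \<Rightarrow> nat) set" where
  "hyperoctahedral n = carrier (hyperoctahedral_group n)"

lemma hyperoctahedral_iff:
  "w \<in> hyperoctahedral n \<longleftrightarrow> w permutes {1..2 * n} \<and>
    (\<forall>i\<in>{1..2 * n}. w (2 * n + 1 - i) = 2 * n + 1 - w i)"
proof -
  let ?r = "rev_perm (2 * n)"
  have "?r \<circ> w \<circ> ?r = w \<longleftrightarrow> (\<forall>i\<in>{1..2 * n}. w (2 * n + 1 - i) = 2 * n + 1 - w i)"
    if w: "w permutes {1..2 * n}"
  proof -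
    have "(?r \<circ> w \<circ> ?r) i = w i \<longleftrightarrow> w (2 * n + 1 - i) = 2 * n + 1 - w i" if i: "i \<in> {1..2 * n}" for i
    proof -
      have "2 * n + 1 - i \<in> {1..2 * n}" using i by auto
      then have "w (2 * n + 1 - i) \<in> {1..2 * n}" "w i \<in> {1..2 * n}"
        using i permutes_in_image[OF w] by blast+
      then show ?thesis using i by (auto simp: rev_perm_def)
    qed
    moreover have "(?r \<circ> w \<circ> ?r) i = w i" if "i \<notin> {1..2 * n}" for i
    proof -
      have "w i = i" using permutes_not_in[OF w that] .
      moreover have "?r i = i" unfolding rev_perm_def using that by (rule if_not_P)
      ultimately show ?thesis by simp
    qed
    ultimately show ?thesis unfolding fun_eq_iff by blast
  qed
  then show ?thesis
    by (auto simp: hyperoctahedral_def hyperoctahedral_group_def sym_group_carrier)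
qed

lemma hyperoctahedralD:
  assumes "w \<in> hyperoctahedral n"
  shows "w permutes {1..2 * n}"
    "i \<in> {1..2 * n} \<Longrightarrow> w (2 * n + 1 - i) = 2 * n + 1 - w i"
    "i \<in> {1..2 * n} \<Longrightarrow> w i \<in> {1..2 * n}"
  using assms permutes_in_image[of w] unfolding hyperoctahedral_iff by blast+

lemma subgroup_hyperoctahedral: "subgroup (hyperoctahedral n) (sym_group (2 * n))"
proof (rule group.subgroupI[OF sym_group_is_group])
  show "hyperoctahedral n \<subseteq> carrier (sym_group (2 * n))"
    using hyperoctahedralD(1) by (auto simp: sym_group_carrier)
  have "id \<in> hyperoctahedral n"
    by (simp add: hyperoctahedral_iff permutes_id)
  then show "hyperoctahedral n \<noteq> {}" by blast
next
  fix w assume w: "w \<in> hyperoctahedral n"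
  note p = hyperoctahedralD(1)[OF w]
  have "inv' w (2 * n + 1 - j) = 2 * n + 1 - inv' w j" if j: "j \<in> {1..2 * n}" for j
  proof -
    have "inv' w j \<in> {1..2 * n}" using j permutes_in_image[OF permutes_inv[OF p]] by blast
    then have "w (2 * n + 1 - inv' w j) = 2 * n + 1 - j"
      using hyperoctahedralD(2)[OF w] permutes_inverses(1)[OF p] by metis
    then show ?thesis using permutes_inverses(2)[OF p] by metis
  qed
  then have "inv' w \<in> hyperoctahedral n"
    unfolding hyperoctahedral_iff using permutes_inv[OF p] by blast
  then show "inv\<^bsub>sym_group (2 * n)\<^esub> w \<in> hyperoctahedral n"
    using p by (simp add: sym_group_carrier)
next
  fix v w assume v: "v \<in> hyperoctahedral n" and w: "w \<in> hyperoctahedral n"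
  have "(v \<circ> w) (2 * n + 1 - i) = 2 * n + 1 - (v \<circ> w) i" if "i \<in> {1..2 * n}" for i
    using hyperoctahedralD(2)[OF w that] hyperoctahedralD(2)[OF v hyperoctahedralD(3)[OF w that]]
    by simp
  then have "v \<circ> w \<in> hyperoctahedral n"
    unfolding hyperoctahedral_iff
    using permutes_compose[OF hyperoctahedralD(1)[OF w] hyperoctahedralD(1)[OF v]] by blast
  then show "v \<otimes>\<^bsub>sym_group (2 * n)\<^esub> w \<in> hyperoctahedral n"
    by (simp add: sym_group_mult)
qed

text \<open>
  Indexing by \<open>{1..<2 * n}\<close> instead of \<open>{1..n}\<close> lists every generator but \<open>adj n\<close> twice.
\<close>

definition hyp_gen :: "nat \<Rightarrow> nat \<Rightarrow> nat \<Rightarrow> nat" where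
  "hyp_gen n i = (if i = n then adj n else adj i \<circ> adj (2 * n - i))"

lemma hyp_gen_apply:
  assumes "i \<in> {1..<2 * n}"
  shows "hyp_gen n i k = (if k = i then Suc i else if k = Suc i then i
    else if k = 2 * n - i then Suc (2 * n - i) else if k = Suc (2 * n - i) then 2 * n - i else k)"
proof (cases "i = n")
  case True
  then show ?thesis by (simp add: hyp_gen_def adj_apply)
next
  case False
  \<comment> \<open>\<open>i\<close> and \<open>2 * n - i\<close> have the same parity, so distinct
    mirrored gaps are never adjacent and the two transpositions are disjoint.\<close>
  have "2 * n - i \<noteq> i" "2 * n - i \<noteq> Suc i" "Suc (2 * n - i) \<noteq> i" "Suc (2 * n - i) \<noteq> Suc i"
    using assms False by (auto; presburger)+
  then show ?thesis using False by (simp add: hyp_gen_def adj_apply)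
qed

lemma hyp_gen_in:
  assumes i: "i \<in> {1..<2 * n}"
  shows "hyp_gen n i \<in> hyperoctahedral n"
proof -
  have j: "2 * n - i \<in> {1..<2 * n}" using i by auto
  have "adj i \<circ> adj (2 * n - i) permutes {1..2 * n}"
    by (rule permutes_compose[OF adj_permutes[OF j] adj_permutes[OF i]])
  then have "hyp_gen n i permutes {1..2 * n}"
    using adj_permutes[OF i] by (cases "i = n") (simp_all add: hyp_gen_def)
  moreover have "hyp_gen n i (2 * n + 1 - k) = 2 * n + 1 - hyp_gen n i k" if "k \<in> {1..2 * n}" for k
  proof -
    define j k' where "j = 2 * n - i" and "k' = 2 * n + 1 - k"
    have sum: "i + j = 2 * n" "k + k' = 2 * n + 1" using i that by (auto simp: j_def k'_def)
    then have swap: "k' = i \<longleftrightarrow> k = Suc j" "k' = Suc i \<longleftrightarrow> k = j"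
      "k' = j \<longleftrightarrow> k = Suc i" "k' = Suc j \<longleftrightarrow> k = i" by linarith+
    have "i \<noteq> Suc j" "j \<noteq> Suc i" using sum(1) by presburger+
    moreover have "k = i \<or> k = Suc i \<or> k = j \<or> k = Suc j \<or> k \<notin> {i, Suc i, j, Suc j}" by blast
    ultimately show ?thesis
      unfolding hyp_gen_apply[OF i] j_def[symmetric] k'_def[symmetric] swap
      using sum by (elim disjE) auto
  qed
  ultimately show ?thesis by (simp add: hyperoctahedral_iff)
qed

lemma hyp_gen_invol:
  assumes "i \<in> {1..<2 * n}"
  shows "hyp_gen n i \<circ> hyp_gen n i = id"
proof
  fix k
  show "(hyp_gen n i \<circ> hyp_gen n i) k = id k"
    using assms by (auto simp: hyp_gen_apply; presburger)
qed

text \<open>Mirroring positions sends the gap after \<open>i\<close> to the gap after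
  \<open>2 * n - i\<close> with its sides exchanged. Mirroring values reverses their order, and the
  two reversals cancel.\<close>

lemma hyperoctahedral_descent:
  assumes w: "w \<in> hyperoctahedral n" and i: "i \<in> {1..<2 * n}"
  shows "w (Suc (2 * n - i)) < w (2 * n - i) \<longleftrightarrow> w (Suc i) < w i"
proof -
  have "w (Suc (2 * n - i)) = 2 * n + 1 - w i" "w (2 * n - i) = 2 * n + 1 - w (Suc i)"
    using hyperoctahedralD(2)[OF w, of i] hyperoctahedralD(2)[OF w, of "Suc i"] i
    by (simp_all add: Suc_diff_le)
  then show ?thesis
    using hyperoctahedralD(3)[OF w, of i] hyperoctahedralD(3)[OF w, of "Suc i"] i by auto
qed

text \<open>For \<open>i \<noteq> n\<close> the first swap leaves the mirrored gap untouched, so its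
  descent is still there and the lemma on \<open>adj\<close> applies twice.\<close>

lemma inversions_comp_hyp_gen:
  assumes w: "w \<in> hyperoctahedral n" and i: "i \<in> {1..<2 * n}" and desc: "w (Suc i) < w i"
  shows "inversions (2 * n) (w \<circ> hyp_gen n i) =
    inversions (2 * n) w - (\<lambda>j. (w (Suc j), w j)) ` {i, 2 * n - i}"
proof (cases "i = n")
  case True
  then show ?thesis
    using inversions_comp_adj[OF hyperoctahedralD(1)[OF w] i desc] by (simp add: hyp_gen_def)
next
  case False
  let ?j = "2 * n - i" and ?v = "w \<circ> adj i"
  have j: "?j \<in> {1..<2 * n}" using i by auto
  have v: "?v permutes {1..2 * n}"
    by (rule permutes_compose[OF adj_permutes[OF i] hyperoctahedralD(1)[OF w]])
  have "?j \<noteq> i" "?j \<noteq> Suc i" "Suc ?j \<noteq> i" "Suc ?j \<noteq> Suc i"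
    using i False by (auto; presburger)+
  then have vj: "?v ?j = w ?j" "?v (Suc ?j) = w (Suc ?j)" by (simp_all add: adj_apply)
  have desc': "?v (Suc ?j) < ?v ?j"
    using hyperoctahedral_descent[OF w i] desc by (simp only: vj)
  have "w \<circ> hyp_gen n i = ?v \<circ> adj ?j"
    using False by (simp add: hyp_gen_def comp_assoc)
  then show ?thesis
    using inversions_comp_adj[OF v j desc'] inversions_comp_adj[OF hyperoctahedralD(1)[OF w] i desc]
    by (simp only: vj) auto
qed

lemma inversions_hyp_gen:
  assumes i: "i \<in> {1..<2 * n}"
  shows "inversions (2 * n) (hyp_gen n i) = {(i, Suc i), (2 * n - i, Suc (2 * n - i))}"
proof -
  let ?g = "hyp_gen n i" and ?j = "2 * n - i"
  have g: "?g i = Suc i" "?g (Suc i) = i" "?g ?j = Suc ?j" "?g (Suc ?j) = ?j"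
    using i by (auto simp: hyp_gen_apply; presburger)+
  have inv: "inv' ?g = ?g"
    by (rule inv_unique_comp) (simp_all only: hyp_gen_invol[OF i])
  have "inversions (2 * n) (?g \<circ> ?g) = inversions (2 * n) ?g - {(i, Suc i), (?j, Suc ?j)}"
    using inversions_comp_hyp_gen[OF hyp_gen_in[OF i] i] by (simp add: g)
  then have "inversions (2 * n) ?g \<subseteq> {(i, Suc i), (?j, Suc ?j)}"
    unfolding hyp_gen_invol[OF i] by auto
  moreover have "(i, Suc i) \<in> inversions (2 * n) ?g" "(?j, Suc ?j) \<in> inversions (2 * n) ?g"
    unfolding inversions_iff inv g using i by auto
  ultimately show ?thesis by blast
qed

definition symmetric_cuts :: "nat \<Rightarrow> nat set \<Rightarrow> bool" where
  "symmetric_cuts n C \<longleftrightarrow> C \<subseteq> {1..<2 * n} \<and> (\<forall>i\<in>C. 2 * n - i \<in> C)"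

lemma symmetric_cuts_iff:
  assumes "symmetric_cuts n C" "i \<in> {1..<2 * n}"
  shows "2 * n - i \<in> C \<longleftrightarrow> i \<in> C"
proof
  assume "2 * n - i \<in> C"
  then have "2 * n - (2 * n - i) \<in> C" using assms(1) by (auto simp: symmetric_cuts_def)
  then show "i \<in> C" using assms(2) by simp
qed (use assms in \<open>auto simp: symmetric_cuts_def\<close>)

lemma symmetric_cuts_ascents:
  assumes w: "w \<in> hyperoctahedral n"
  shows "symmetric_cuts n (ascents (2 * n) w)"
  unfolding symmetric_cuts_def
proof (intro conjI ballI ascents_subset)
  fix i assume i: "i \<in> ascents (2 * n) w"
  then have i': "i \<in> {1..<2 * n}" by (simp add: ascents_def)
  have "\<not> w (Suc (2 * n - i)) < w (2 * n - i)"
    using hyperoctahedral_descent[OF w i'] i by (simp add: ascents_def)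
  moreover have "w (Suc (2 * n - i)) \<noteq> w (2 * n - i)"
    using permutes_inj[OF hyperoctahedralD(1)[OF w]] by (metis injD n_not_Suc_n)
  ultimately show "2 * n - i \<in> ascents (2 * n) w"
    using i' by (auto simp: ascents_def)
qed

text \<open>The mirror image of the block from \<open>a\<close> to \<open>b\<close> runs from
  \<open>2 * n + 1 - b\<close> to \<open>2 * n + 1 - a\<close>. By symmetry of the cuts it is again
  a block, and reversing a block commutes with mirroring.\<close>

lemma block_rev_symmetric:
  assumes sym: "symmetric_cuts n C"
  shows "block_rev (2 * n) C \<in> hyperoctahedral n"
proof -
  have C: "C \<subseteq> {1..<2 * n}" using sym by (simp add: symmetric_cuts_def)
  have "block_rev (2 * n) C (2 * n + 1 - i) = 2 * n + 1 - block_rev (2 * n) C i"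
    if i: "i \<in> {1..2 * n}" for i
  proof -
    define a b where "a = block_start C i" and "b = block_end (2 * n) C i"
    have ab: "1 \<le> a" "a \<le> i" "i \<le> b" "b \<le> 2 * n"
      using block_start_pos[of C i] block_start_le[of i C] block_end_ge[OF C, of i]
        block_end_le[OF C, of i] i by (auto simp: a_def b_def)
    have no_cut: "c \<notin> C" if "2 * n + 1 - b \<le> c" "c < 2 * n + 1 - a" for c
    proof -
      have "2 * n - c \<notin> C"
        using no_cut_in_block[OF C, of i "2 * n - c"] that ab i by (simp add: a_def b_def)
      moreover have "c \<in> {1..<2 * n}" using that ab by auto
      ultimately show ?thesis using symmetric_cuts_iff[OF sym] by blast
    qed
    have start: "2 * n + 1 - b = 1 \<or> 2 * n + 1 - b - 1 \<in> C"
      using block_end_cut[OF C, of i] sym by (auto simp: b_def symmetric_cuts_def)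
    have end': "2 * n + 1 - a = 2 * n \<or> 2 * n + 1 - a \<in> C"
    proof (cases "a = 1")
      case False
      then have "a - 1 \<in> C" using block_start_cut[of C i] by (simp add: a_def)
      then have "2 * n - (a - 1) \<in> C" using sym by (simp add: symmetric_cuts_def)
      moreover have "2 * n - (a - 1) = 2 * n + 1 - a" using ab by simp
      ultimately show ?thesis by simp
    qed simp
    have "block_start C (2 * n + 1 - i) = 2 * n + 1 - b"
      "block_end (2 * n) C (2 * n + 1 - i) = 2 * n + 1 - a"
      by (rule block_unique[OF C _ _ _ _ no_cut start end']; use ab in simp)+
    then show ?thesis
      using ab i by (auto simp: block_rev_def a_def[symmetric] b_def[symmetric])
  qed
  then show ?thesis
    unfolding hyperoctahedral_iff using block_rev_permutes[OF C] by blast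
qed

lemma pop_system_hyperoctahedral:
  "pop_system (2 * n) (hyperoctahedral n) (hyp_gen n) (\<lambda>i. {i, 2 * n - i})
     {(a, b). a + b = 2 * n + 1} 2"
proof (rule pop_system.intro)
  show "subgroup (hyperoctahedral n) (sym_group (2 * n))"
    by (rule subgroup_hyperoctahedral)
  show "(g a, g b) \<in> {(a, b). a + b = 2 * n + 1}"
    if "g \<in> hyperoctahedral n" "(a, b) \<in> {(a, b). a + b = 2 * n + 1}" "a \<in> {1..2 * n}" for g a b
  proof -
    have "b = 2 * n + 1 - a" using that by auto
    then show ?thesis
      using hyperoctahedralD(2,3)[OF that(1,3)] by auto
  qed
  show "card (inversions (2 * n) (hyp_gen n i)) +
      card (inversions (2 * n) (hyp_gen n i) \<inter> {(a, b). a + b = 2 * n + 1}) = 2"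
    if i: "i \<in> {1..<2 * n}" for i
  \<comment> \<open>The middle generator has the single inversion \<open>(n, Suc n)\<close>, a pair
    of opposite values counted twice. The others have two inversions, neither of them
    opposite.\<close>
  proof (cases "i = n")
    case True
    then show ?thesis using inversions_hyp_gen[OF i] by simp
  next
    case False
    then have "(2 * n - i, Suc (2 * n - i)) \<noteq> (i, Suc i)" using i by auto
    moreover have "{(i, Suc i), (2 * n - i, Suc (2 * n - i))} \<inter> {(a, b). a + b = 2 * n + 1} = {}"
      using i False by auto
    ultimately show ?thesis unfolding inversions_hyp_gen[OF i] by simp
  qed
  show "j \<in> {1..<2 * n} \<and> w (Suc j) < w j"
    if "w \<in> hyperoctahedral n" "i \<in> {1..<2 * n}" "w (Suc i) < w i" "j \<in> {i, 2 * n - i}" for w i j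
    using that hyperoctahedral_descent[OF that(1,2)] by auto
  show "block_rev (2 * n) (ascents (2 * n) w) \<in> hyperoctahedral n" if "w \<in> hyperoctahedral n" for w
    using block_rev_symmetric symmetric_cuts_ascents that by blast
  show "hyp_gen n i i = Suc i" "hyp_gen n i (Suc i) = i" if "i \<in> {1..<2 * n}" for i
    by (simp_all add: hyp_gen_apply[OF that])
  show "inversions (2 * n) (w \<circ> hyp_gen n i) =
      inversions (2 * n) w - (\<lambda>j. (w (Suc j), w j)) ` {i, 2 * n - i}"
    if "w \<in> hyperoctahedral n" "i \<in> {1..<2 * n}" "w (Suc i) < w i" for w i
    using inversions_comp_hyp_gen that by blast
qed (simp_all add: hyp_gen_in hyp_gen_invol add.commute)

text \<open>The bound on \<open>n\<close> matters: for \<open>n = 0\<close> the left side contains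
  \<open>adj 0\<close>, while the right side is empty.\<close>

lemma hyperoctahedral_gens_eq:
  assumes "n \<ge> 1"
  shows "hyperoctahedral_gens n = hyp_gen n ` {1..<2 * n}"
proof (intro equalityI subsetI)
  fix s assume "s \<in> hyperoctahedral_gens n"
  then consider i where "i \<in> {1..n - 1}" "s = adj i \<circ> adj (2 * n - i)" | "s = adj n"
    by (auto simp: hyperoctahedral_gens_def)
  then show "s \<in> hyp_gen n ` {1..<2 * n}"
  proof cases
    case (1 i)
    then show ?thesis by (intro image_eqI[of _ _ i]) (auto simp: hyp_gen_def)
  next
    case 2
    then show ?thesis using assms by (intro image_eqI[of _ _ n]) (auto simp: hyp_gen_def)
  qed
next
  fix s assume "s \<in> hyp_gen n ` {1..<2 * n}"
  then obtain i where i: "i \<in> {1..<2 * n}" "s = hyp_gen n i" by blast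
  consider "i < n" | "i = n" | "n < i" by linarith
  then show "s \<in> hyperoctahedral_gens n"
  proof cases
    case 3
    have "2 * n - i \<noteq> n" using i(1) 3 by auto
    moreover have "hyp_gen n i = hyp_gen n (2 * n - i)"
    proof
      show "hyp_gen n i k = hyp_gen n (2 * n - i) k" for k
        using i(1) hyp_gen_apply[of i n k] hyp_gen_apply[of "2 * n - i" n k] 3 by auto
    qed
    ultimately have "s = adj (2 * n - i) \<circ> adj (2 * n - (2 * n - i))"
      unfolding i(2) by (simp only: hyp_gen_def[of n "2 * n - i"] if_False)
    moreover have "2 * n - i \<in> {1..n - 1}" using i(1) 3 by auto
    ultimately show ?thesis unfolding hyperoctahedral_gens_def by blast
  qed (use i in \<open>auto simp: hyperoctahedral_gens_def hyp_gen_def\<close>)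
qed

lemma pop_sortable_B_eq:
  assumes "n \<ge> 1"
  shows "pop_sortable_B t n =
    pop_stack_sortable t (sym_group (2 * n)\<lparr>carrier := hyperoctahedral n\<rparr>) (hyp_gen n ` {1..<2 * n})"
  using hyperoctahedral_gens_eq[OF assms]
  by (simp add: hyperoctahedral_def hyperoctahedral_group_def)

section \<open>Symmetric pairs and their lower halves\<close>

definition mirror_cuts :: "nat \<Rightarrow> nat set \<Rightarrow> nat set" where
  "mirror_cuts n C = C \<union> (\<lambda>i. 2 * n - i) ` C"

lemma symmetric_mirror_cuts:
  assumes "C \<subseteq> {1..n}"
  shows "symmetric_cuts n (mirror_cuts n C)" "mirror_cuts n C \<inter> {1..n} = C"
proof -
  have C: "1 \<le> i \<and> i \<le> n" if "i \<in> C" for i using assms that by auto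
  show "symmetric_cuts n (mirror_cuts n C)"
    unfolding symmetric_cuts_def mirror_cuts_def
  proof (intro conjI ballI subsetI)
    fix i assume "i \<in> C \<union> (\<lambda>i. 2 * n - i) ` C"
    then obtain j where j: "j \<in> C" "i = j \<or> i = 2 * n - j" by blast
    then show "i \<in> {1..<2 * n}" using C[OF j(1)] by auto
    have "2 * n - i = 2 * n - j \<or> 2 * n - i = j" using j C[OF j(1)] by auto
    then show "2 * n - i \<in> C \<union> (\<lambda>i. 2 * n - i) ` C" using j(1) by blast
  qed
  have "2 * n - i \<in> C" if "i \<in> C" "2 * n - i \<le> n" for i
  proof -
    have "2 * n - i = i" using C[OF that(1)] that(2) by auto
    then show ?thesis using that(1) by simp
  qed
  then show "mirror_cuts n C \<inter> {1..n} = C"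
    using C by (auto simp: mirror_cuts_def)
qed

lemma mirror_cuts_symmetric:
  assumes "symmetric_cuts n C"
  shows "mirror_cuts n (C \<inter> {1..n}) = C"
proof (intro equalityI subsetI)
  fix i assume "i \<in> mirror_cuts n (C \<inter> {1..n})"
  then show "i \<in> C" using assms by (auto simp: mirror_cuts_def symmetric_cuts_def)
next
  fix i assume i: "i \<in> C"
  then have "i \<in> {1..<2 * n}" "2 * n - i \<in> C" using assms by (auto simp: symmetric_cuts_def)
  then have "i \<in> C \<inter> {1..n} \<or> 2 * n - i \<in> C \<inter> {1..n} \<and> i = 2 * n - (2 * n - i)"
    using i by auto
  then show "i \<in> mirror_cuts n (C \<inter> {1..n})"
    unfolding mirror_cuts_def by blast
qed

lemma uncut_neighbour_mirror:
  assumes "symmetric_cuts n C" "q \<in> {1..<2 * n}"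
  shows "uncut_neighbour (2 * n - 1) C (2 * n - q) \<longleftrightarrow> uncut_neighbour (2 * n - 1) C q"
proof -
  have mem: "2 * n - p \<in> {1..2 * n - 1} - C \<longleftrightarrow> p \<in> {1..2 * n - 1} - C" if "p \<le> 2 * n" for p
  proof (cases "p \<in> {1..<2 * n}")
    case True
    then show ?thesis using symmetric_cuts_iff[OF assms(1) True] by auto
  qed (use that in auto)
  have "2 * n - q - 1 = 2 * n - Suc q" "Suc (2 * n - q) = 2 * n - (q - 1)"
    using assms(2) by auto
  then show ?thesis
    unfolding uncut_neighbour_def using mem[of "Suc q"] mem[of "q - 1"] assms(2) by auto
qed

text \<open>Only \<open>q = n\<close> has a neighbour beyond the half, namely \<open>Suc n\<close>.
  By symmetry it is uncut exactly when \<open>n - 1\<close> is, so forgetting it loses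
  nothing.\<close>

lemma uncut_neighbour_half:
  assumes sym: "symmetric_cuts n C" and q: "q \<in> {1..n}"
  shows "uncut_neighbour n (C \<inter> {1..n}) q \<longleftrightarrow> uncut_neighbour (2 * n - 1) C q"
proof (cases "q = n")
  case True
  have "Suc n \<in> {1..2 * n - 1} - C \<longleftrightarrow> n - 1 \<in> {1..2 * n - 1} - C"
  \<comment> \<open>For \<open>n = 1\<close> both neighbours, 0 and 2, are out of range.\<close>
  proof (cases "n = 1")
    case False
    then have "n - 1 \<in> {1..<2 * n}" "Suc n = 2 * n - (n - 1)" using q True by auto
    then show ?thesis using symmetric_cuts_iff[OF sym, of "n - 1"] by auto
  qed auto
  then show ?thesis using True q by (auto simp: uncut_neighbour_def)
next
  case False
  then have "Suc q \<in> {1..n}" using q by auto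
  then show ?thesis using q by (auto simp: uncut_neighbour_def)
qed

text \<open>Both defining conditions are invariant under sending \<open>q\<close> to
  \<open>2 * n - q\<close>, so they may be tested on \<open>{1..n}\<close>, which meets every
  orbit.\<close>

lemma good_pairs_half:
  assumes C: "symmetric_cuts n C" and E: "symmetric_cuts n E"
  shows "(C \<inter> {1..n}, E \<inter> {1..n}) \<in> good_pairs n \<longleftrightarrow> (C, E) \<in> good_pairs (2 * n - 1)"
proof -
  have half: "(\<forall>q\<in>{1..<2 * n}. P q) \<longleftrightarrow> (\<forall>q\<in>{1..n}. P q)"
    if "\<And>q. q \<in> {1..<2 * n} \<Longrightarrow> P (2 * n - q) \<longleftrightarrow> P q" for P
  proof (intro iffI ballI)
    fix q assume all: "\<forall>q\<in>{1..n}. P q" and q: "q \<in> {1..<2 * n}"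
    then have "q \<in> {1..n} \<or> 2 * n - q \<in> {1..n}" by auto
    then show "P q" using all that[OF q] by blast
  next
    fix q assume all: "\<forall>q\<in>{1..<2 * n}. P q" and q: "q \<in> {1..n}"
    then show "P q" by auto
  qed
  have sub: "C \<union> E \<subseteq> {1..<2 * n}" using C E by (simp add: symmetric_cuts_def)
  have eq: "{1..2 * n - 1} = {1..<2 * n}" by auto
  let ?Q = "\<lambda>q. q \<in> C - E \<longrightarrow> uncut_neighbour (2 * n - 1) C q"
  have "(C, E) \<in> good_pairs (2 * n - 1) \<longleftrightarrow>
      (\<forall>q\<in>{1..<2 * n}. q \<in> C \<union> E) \<and> (\<forall>q\<in>{1..<2 * n}. ?Q q)"
    unfolding good_pairs_def eq using sub by blast
  also have "(\<forall>q\<in>{1..<2 * n}. q \<in> C \<union> E) \<longleftrightarrow> (\<forall>q\<in>{1..n}. q \<in> C \<union> E)"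
    by (rule half) (use symmetric_cuts_iff[OF C] symmetric_cuts_iff[OF E] in blast)
  also have "(\<forall>q\<in>{1..<2 * n}. ?Q q) \<longleftrightarrow> (\<forall>q\<in>{1..n}. ?Q q)"
    by (rule half)
      (simp only: uncut_neighbour_mirror[OF C] symmetric_cuts_iff[OF C] symmetric_cuts_iff[OF E] Diff_iff)
  also have "(\<forall>q\<in>{1..n}. ?Q q) \<longleftrightarrow> (\<forall>q\<in>{1..n}. q \<in> C - E \<longrightarrow> uncut_neighbour n (C \<inter> {1..n}) q)"
    using uncut_neighbour_half[OF C] by blast
  finally show ?thesis
    unfolding good_pairs_def by blast
qed

lemma bij_betw_good_pairs_half:
  "bij_betw (\<lambda>(C, E). (C \<inter> {1..n}, E \<inter> {1..n}))
     {(C, E) \<in> good_pairs (2 * n - 1). symmetric_cuts n C \<and> symmetric_cuts n E} (good_pairs n)"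
proof (rule bij_betwI[where g = "\<lambda>(C, E). (mirror_cuts n C, mirror_cuts n E)"])
  let ?A = "{(C, E) \<in> good_pairs (2 * n - 1). symmetric_cuts n C \<and> symmetric_cuts n E}"
  show "(\<lambda>(C, E). (C \<inter> {1..n}, E \<inter> {1..n})) \<in> ?A \<rightarrow> good_pairs n"
    using good_pairs_half by auto
  have sub: "C \<subseteq> {1..n}" "E \<subseteq> {1..n}" if "(C, E) \<in> good_pairs n" for C E
    using good_pairs_subset(1) that by blast+
  show "(\<lambda>(C, E). (mirror_cuts n C, mirror_cuts n E)) \<in> good_pairs n \<rightarrow> ?A"
  proof
    fix z assume z: "z \<in> good_pairs n"
    obtain C E where CE: "z = (C, E)" by fastforce
    note C = symmetric_mirror_cuts[OF sub(1)[OF z[unfolded CE]]]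
      and E = symmetric_mirror_cuts[OF sub(2)[OF z[unfolded CE]]]
    have "(mirror_cuts n C, mirror_cuts n E) \<in> good_pairs (2 * n - 1)"
      using good_pairs_half[OF C(1) E(1)] z unfolding C(2) E(2) CE by blast
    then show "(case z of (C, E) \<Rightarrow> (mirror_cuts n C, mirror_cuts n E)) \<in> ?A"
      using C(1) E(1) by (simp add: CE)
  qed
  show "(case case z of (C, E) \<Rightarrow> (C \<inter> {1..n}, E \<inter> {1..n}) of
      (C, E) \<Rightarrow> (mirror_cuts n C, mirror_cuts n E)) = z" if "z \<in> ?A" for z
    using that mirror_cuts_symmetric by auto
  show "(case case z of (C, E) \<Rightarrow> (mirror_cuts n C, mirror_cuts n E) of
      (C, E) \<Rightarrow> (C \<inter> {1..n}, E \<inter> {1..n})) = z" if "z \<in> good_pairs n" for z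
  proof -
    obtain C E where CE: "z = (C, E)" by fastforce
    show ?thesis
      using symmetric_mirror_cuts(2)[OF sub(1)[OF that[unfolded CE]]]
        symmetric_mirror_cuts(2)[OF sub(2)[OF that[unfolded CE]]] by (simp only: CE prod.case)
  qed
qed

text \<open>The source of "\<open>2 * k\<close> or \<open>2 * k + 1\<close>". With x cuts below
  \<open>n\<close> and y in {0, 1} cuts at \<open>n\<close>, there are 2 x + y + 1 runs and x + y
  cuts in the lower half; for x + y = k the run number is 2 k + 1 if y = 0 and 2 k if y = 1.\<close>

lemma card_symmetric_cuts:
  assumes sym: "symmetric_cuts n C"
  shows "Suc (card C) \<in> {2 * k, 2 * k + 1} \<longleftrightarrow> card (C \<inter> {1..n}) = k"
proof -
  have C: "C \<subseteq> {1..<2 * n}" "finite C"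
    using sym finite_cuts by (auto simp: symmetric_cuts_def)
  have opp: "2 * n - i \<in> C" if "i \<in> C" for i using sym that by (simp add: symmetric_cuts_def)
  have bij: "bij_betw (\<lambda>i. 2 * n - i) (C \<inter> {..<n}) (C \<inter> {n<..})"
    by (rule bij_betwI[where g = "\<lambda>i. 2 * n - i"]) (use C opp in auto)
  have "C = (C \<inter> {..<n}) \<union> (C \<inter> {n}) \<union> (C \<inter> {n<..})" by auto
  also have "card \<dots> = card (C \<inter> {..<n}) + card (C \<inter> {n}) + card (C \<inter> {n<..})"
    by (rule card_Int_Un3[OF C(2)]) auto
  finally have 1: "card C = 2 * card (C \<inter> {..<n}) + card (C \<inter> {n})"
    using bij_betw_same_card[OF bij] by simp
  have "C \<inter> {1..n} = (C \<inter> {..<n}) \<union> (C \<inter> {n})" using C by auto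
  then have 2: "card (C \<inter> {1..n}) = card (C \<inter> {..<n}) + card (C \<inter> {n})"
    using card_Int_Un3[OF C(2), of "{..<n}" "{n}" "{}"] by simp
  have "card (C \<inter> {n}) = 0 \<or> card (C \<inter> {n}) = 1"
    by (cases "n \<in> C") auto
  moreover have "Suc (2 * x + y) \<in> {2 * k, 2 * k + 1} \<longleftrightarrow> x + y = k" if "y = 0 \<or> y = 1" for x y
    using that unfolding insert_iff empty_iff by presburger
  ultimately show ?thesis unfolding 1 2 by blast
qed

lemma ex_bij_betw_pop_sortable_B:
  assumes n: "n \<ge> 1"
  obtains \<Phi> where "bij_betw \<Phi> (pop_sortable_B 2 n) (good_pairs n)"
    "\<And>w k. w \<in> pop_sortable_B 2 n \<Longrightarrow>
      card (descending_runs (2 * n) w) \<in> {2 * k, 2 * k + 1} \<longleftrightarrow> card (fst (\<Phi> w)) = k"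
proof -
  interpret pop_system "2 * n" "hyperoctahedral n" "hyp_gen n" "\<lambda>i. {i, 2 * n - i}"
    "{(a, b). a + b = 2 * n + 1}" 2
    by (rule pop_system_hyperoctahedral)
  let ?\<Phi> = "\<lambda>w. (ascents (2 * n) w, ascents (2 * n) (pop G S w))"
  let ?h = "\<lambda>(C, E). (C \<inter> {1..n}, E \<inter> {1..n})"
  \<comment> \<open>For the forward direction, \<open>C\<close> is recovered as the ascent set of
    its reversal, and ascents in type B are symmetric.\<close>
  have sym_iff: "block_rev (2 * n) C \<in> hyperoctahedral n \<longleftrightarrow> symmetric_cuts n C"
    if "C \<subseteq> {1..<2 * n}" for C
    using block_rev_symmetric symmetric_cuts_ascents[of "block_rev (2 * n) C" n]
      ascents_block_rev[OF that] by auto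
  have eq: "{(C, E) \<in> good_pairs (2 * n - 1).
        block_rev (2 * n) C \<in> hyperoctahedral n \<and> block_rev (2 * n) E \<in> hyperoctahedral n} =
      {(C, E) \<in> good_pairs (2 * n - 1). symmetric_cuts n C \<and> symmetric_cuts n E}"
  proof -
    have "(C, E) \<in> good_pairs (2 * n - 1) \<and>
          block_rev (2 * n) C \<in> hyperoctahedral n \<and> block_rev (2 * n) E \<in> hyperoctahedral n \<longleftrightarrow>
        (C, E) \<in> good_pairs (2 * n - 1) \<and> symmetric_cuts n C \<and> symmetric_cuts n E" for C E
      using sym_iff[OF good_pairsD(1)] sym_iff[OF good_pairsD(2)] by blast
    then show ?thesis by (simp only:)
  qed
  have "bij_betw (?h \<circ> ?\<Phi>) (pop_sortable_B 2 n) (good_pairs n)"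
    unfolding pop_sortable_B_eq[OF n]
    by (rule bij_betw_trans[OF bij_betw_good_pairs[unfolded eq] bij_betw_good_pairs_half])
  moreover have "card (descending_runs (2 * n) w) \<in> {2 * k, 2 * k + 1} \<longleftrightarrow> card (fst ((?h \<circ> ?\<Phi>) w)) = k"
    if "w \<in> pop_sortable_B 2 n" for w k
  proof -
    have w: "w \<in> hyperoctahedral n"
      using that by (simp add: pop_stack_sortable_def hyperoctahedral_def)
    show ?thesis
      using card_descending_runs[OF permutes_W[OF w]] n
        card_symmetric_cuts[OF symmetric_cuts_ascents[OF w], of k] by simp
  qed
  ultimately show ?thesis by (rule that)
qed

lemma card_filter_bij_betw:
  assumes f: "bij_betw f A B" and "\<And>a. a \<in> A \<Longrightarrow> P a \<longleftrightarrow> Q (f a)"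
  shows "card {a \<in> A. P a} = card {b \<in> B. Q b}"
proof (rule bij_betw_same_card)
  have image: "f ` {a \<in> A. P a} = {b \<in> B. Q b}"
    using assms by (auto simp: bij_betw_def)
  show "bij_betw f {a \<in> A. P a} {b \<in> B. Q b}"
    by (rule bij_betw_subset[OF f _ image]) blast
qed

theorem theorem1p8:
  shows "(\<forall>n\<ge>1. \<forall>k.
            card {w \<in> pop_sortable_B 2 n. card (descending_runs (2 * n) w) \<in> {2 * k, 2 * k + 1}}
          = card {w \<in> pop_sortable_S 2 (n + 1). card (descending_runs (n + 1) w) = k + 1})
       \<and> (Abs_fps (\<lambda>n. if n \<ge> 1 then of_nat (card (pop_sortable_B 2 n)) else 0) :: rat fps)
          = Abs_fps (\<lambda>n. if n \<ge> 1 then of_nat (card (pop_sortable_S 2 (n + 1))) else 0)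
       \<and> (Abs_fps (\<lambda>n. if n \<ge> 1 then of_nat (card (pop_sortable_S 2 (n + 1))) else 0) :: rat fps)
          = 2 * fps_X * (1 + fps_X + fps_X ^ 2) / (1 - 2 * fps_X - fps_X ^ 2 - 2 * fps_X ^ 3)"
proof (intro conjI allI impI)
  fix n k :: nat assume n: "n \<ge> 1"
  obtain \<Phi> where \<Phi>: "bij_betw \<Phi> (pop_sortable_B 2 n) (good_pairs n)"
    "\<And>w k. w \<in> pop_sortable_B 2 n \<Longrightarrow>
      card (descending_runs (2 * n) w) \<in> {2 * k, 2 * k + 1} \<longleftrightarrow> card (fst (\<Phi> w)) = k"
    by (rule ex_bij_betw_pop_sortable_B[OF n]) (rule that; blast)
  obtain \<Psi> where \<Psi>: "bij_betw \<Psi> (pop_sortable_S 2 (n + 1)) (good_pairs n)"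
    "\<And>w. w \<in> pop_sortable_S 2 (n + 1) \<Longrightarrow> card (descending_runs (n + 1) w) = card (fst (\<Psi> w)) + 1"
    by (rule ex_bij_betw_pop_sortable_S[of n]) (rule that; blast)
  have "card {w \<in> pop_sortable_B 2 n. card (descending_runs (2 * n) w) \<in> {2 * k, 2 * k + 1}}
      = card {z \<in> good_pairs n. card (fst z) = k}"
    by (rule card_filter_bij_betw[OF \<Phi>(1)]) (rule \<Phi>(2))
  also have "\<dots> = card {w \<in> pop_sortable_S 2 (n + 1). card (descending_runs (n + 1) w) = k + 1}"
    using card_filter_bij_betw[OF \<Psi>(1), of "\<lambda>w. card (descending_runs (n + 1) w) = k + 1"
      "\<lambda>z. card (fst z) = k"] \<Psi>(2) by simp
  finally show "card {w \<in> pop_sortable_B 2 n. card (descending_runs (2 * n) w) \<in> {2 * k, 2 * k + 1}}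
      = card {w \<in> pop_sortable_S 2 (n + 1). card (descending_runs (n + 1) w) = k + 1}" .
next
  have B: "card (pop_sortable_B 2 n) = card (good_pairs n)" if "n \<ge> 1" for n
    using ex_bij_betw_pop_sortable_B[OF that] bij_betw_same_card by metis
  have S: "card (pop_sortable_S 2 (n + 1)) = card (good_pairs n)" for n
    using ex_bij_betw_pop_sortable_S[of n] bij_betw_same_card by metis
  show "(Abs_fps (\<lambda>n. if n \<ge> 1 then of_nat (card (pop_sortable_B 2 n)) else 0) :: rat fps)
      = Abs_fps (\<lambda>n. if n \<ge> 1 then of_nat (card (pop_sortable_S 2 (n + 1))) else 0)"
    unfolding S by (intro arg_cong[of _ _ Abs_fps] ext) (simp add: B)
  show "(Abs_fps (\<lambda>n. if n \<ge> 1 then of_nat (card (pop_sortable_S 2 (n + 1))) else 0) :: rat fps)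
      = 2 * fps_X * (1 + fps_X + fps_X ^ 2) / (1 - 2 * fps_X - fps_X ^ 2 - 2 * fps_X ^ 3)"
    unfolding S by (rule good_pairs_fps) simp
qed

end
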